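(* Let $\mathcal{C}$ be a locally small finitely complete category. For any internal category $\mathsf{M}=(O,M,d,c,\eta,\mu)$ in $\mathcal{C}$ the following hold. 1. The functors $P_{\mathsf{M}}\colon \mathrm{Conv}_{\mathsf{M}}\to\mathcal{C}/O$ and $Q_{\mathsf{M}}\colon {}^{sp}\mathrm{End}_{\mathsf{M}}\to\mathcal{C}/O$ are discrete fibrations whose change of base functors $P_{\mathsf{M}}^*,Q_{\mathsf{M}}^*\colon(\mathcal{C}/O)^{\mathrm{op}}\to\mathrm{Set}$ are naturally isomorphic and factor over the category $\mathrm{Mon}$ of monoids. 2. The respective cartesian isomorphism $E\colon \mathrm{Conv}_{\mathsf{M}}\to{}^{sp}\mathrm{End}_{\mathsf{M}}$ (isomorphism of categories over $\mathcal{C}/O$) and its inverse $L\colon{}^{sp}\mathrm{End}_{\mathsf{M}}\to\mathrm{Conv}_{\mathsf{M}}$ act as follows: $$E\big((\mathsf{f}_A\xrightarrow{\alpha}\bar M)\xrightarrow{\phi}(\mathsf{g}_B\xrightarrow{\beta}\bar M)\big)=(\mathsf{f}_A\xrightarrow{\tilde\alpha}\mathsf{f}_A\otimes\bar M)\xrightarrow{(\phi,\phi)}(\mathsf{g}_B\xrightarrow{\tilde\beta}\mathsf{g}_B\otimes\bar M),$$ $$L\big((\mathsf{f}_A\xrightarrow{\alpha}\mathsf{f}_A\otimes\bar M)\xrightarrow{(\phi,\phi)}(\mathsf{g}_B\xrightarrow{\beta}\mathsf{g}_B\otimes\bar M)\big)=(\mathsf{f}_A\xrightarrow{\bar\alpha}\bar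 M)\xrightarrow{\phi}(\mathsf{g}_B\xrightarrow{\bar\beta}\bar M).$$
   Context: Spans. For an object $O$ of $\mathcal{C}$, $\mathcal{C}_O$ is the monoidal category whose objects are spans $\bar X=(O\xleftarrow{x}X\xrightarrow{x'}O)$ and whose morphisms (called 2-cells) $\bar X\to\bar Z=(O\xleftarrow{z}Z\xrightarrow{z'}O)$ are $\mathcal{C}$-morphisms $t\colon X\to Z$ with $z\circ t=x$, $z'\circ t=x'$. For $\bar Y=(O\xleftarrow{y}Y\xrightarrow{y'}O)$, the underlying object of $\bar Y\otimes\bar X$ is the pullback of $x'\colon X\to O$ and $y\colon Y\to O$; its left leg is $x\circ p_X$ and its right leg is $y'\circ p_Y$ ($p_X,p_Y$ the pullback projections). On 2-cells $\otimes$ is induced by the pullback property. The unit is $\bar O=(O\xleftarrow{\mathrm{id}}O\xrightarrow{\mathrm{id}}O)$. Associativity and unit isomorphisms are suppressed. For $f\colon A\to O$ write $\mathsf{f}_A=(O\xleftarrow{f}A\xrightarrow{f}O)$; $\widehat{\mathcal{C}}_O$ is the full subcategory of $\mathcal{C}_O$ on these spans, and is identified with $\mathcal{C}/O$. Each $\mathsf{f}_A\otimes\mathsf{g}_B$ is a product in $\widehat{\mathcal{C}}_O$; $\Delta\colon\mathsf{f}_A\to\mathsf{f}_A\otimes\mathsf{f}_A$ is the diagonal. Internal category. An internal category $\mathsf{M}=(O,M,d,c,\eta,\mu)$ in $\mathcal{C}$ (with domain $d$, codomain $c$, identities $\eta$, composition $\mu$) is the same as a monoid $(\bar M,\eta,\mu)$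 in $\mathcal{C}_O$ with $\bar M=(O\xleftarrow{d}M\xrightarrow{c}O)$, $\eta\colon\bar O\to\bar M$, $\mu\colon\bar M\otimes\bar M\to\bar M$ (on generalized elements, $\mu(m,n)$ is defined for $d(m)=c(n)$ and is "$m$ after $n$"). The object $\mathsf{f}_A\otimes\bar M$ has as underlying object the pullback of $f$ and $c$, with projections $\pi_A$ to $A$ and $\pi_M$ to $M$, left leg $d\circ\pi_M$ and right leg $f\circ\pi_A$; $\pi_M$ is a 2-cell $\mathsf{f}_A\otimes\bar M\to\bar M$. For 2-cells $\xi\colon\mathsf{f}_A\to\mathsf{f}_A$, $\upsilon\colon\mathsf{f}_A\to\bar M$, $\langle\xi,\upsilon\rangle\colon\mathsf{f}_A\to\mathsf{f}_A\otimes\bar M$ is the 2-cell with $\pi_A\langle\xi,\upsilon\rangle=\xi$, $\pi_M\langle\xi,\upsilon\rangle=\upsilon$. For a 2-cell $\alpha\colon\mathsf{f}_A\to\bar M$ put $\tilde\alpha=\langle\mathrm{id},\alpha\rangle\colon\mathsf{f}_A\to\mathsf{f}_A\otimes\bar M$; for a 2-cell $\alpha\colon\mathsf{f}_A\to\mathsf{f}_A\otimes\bar M$ put $\bar\alpha=\pi_M\circ\alpha\colon\mathsf{f}_A\to\bar M$. Categories and functors. $\mathrm{Conv}_{\mathsf{M}}$ has as objects all 2-cells $\alpha\colon\mathsf{f}_A\to\bar M$ ($f\colon A\to O$ in $\mathcal{C}/O$), and as morphisms $\alpha\to(\beta\colon\mathsf{g}_B\to\bar M)$ all 2-cells $\phi\colon\mathsf{f}_A\to\mathsf{g}_B$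 with $\beta\circ\phi=\alpha$; $P_{\mathsf{M}}$ sends $\alpha$ to $(f\colon A\to O)$ and $\phi$ to $\phi$. $\mathrm{End}_{\mathsf{M}}$ has as objects all 2-cells $\alpha\colon\mathsf{f}_A\to\mathsf{f}_A\otimes\bar M$ and as morphisms $\alpha\to(\beta\colon\mathsf{g}_B\to\mathsf{g}_B\otimes\bar M)$ all pairs $(\sigma,\tau)$ of 2-cells $\mathsf{f}_A\to\mathsf{g}_B$ with $\beta\circ\sigma=(\tau\otimes\mathrm{id}_{\bar M})\circ\alpha$. An object $\alpha$ is simply presented if $\alpha=\langle\mathrm{id},\bar\alpha\rangle$; ${}^{sp}\mathrm{End}_{\mathsf{M}}$ is the full subcategory of $\mathrm{End}_{\mathsf{M}}$ on these. All its morphisms are of the form $(\sigma,\sigma)$; $Q_{\mathsf{M}}$ sends $\alpha\colon\mathsf{f}_A\to\mathsf{f}_A\otimes\bar M$ to $(f\colon A\to O)$ and $(\sigma,\sigma)$ to $\sigma$. Discrete fibrations. A functor $P\colon\mathcal{E}\to\mathcal{A}$ with small fibres is a discrete fibration if for each object $X$ of $\mathcal{E}$ and each $f\colon A'\to PX$ there is a unique $g\colon X'\to X$ in $\mathcal{E}$ with $Pg=f$. Its change of base functor $P^*\colon\mathcal{A}^{\mathrm{op}}\to\mathrm{Set}$ sends $A$ to the fibre over $A$ and $\phi\colon A\to B$ to the map sending $b\in P^*(B)$ to the domain of the unique lift of $\phi$ with codomain $b$. Monoid structures meant. $P^*_{\mathsf{M}}(\mathsf{f}_A)=\mathcal{C}_O(\mathsf{f}_A,\bar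 M)$ carries the convolution structure $\phi\ast\psi=\mu\circ(\phi\otimes\psi)\circ\Delta$ with unit $\eta\circ f$. $Q^*_{\mathsf{M}}(\mathsf{f}_A)$, the set of simply presented 2-cells $\mathsf{f}_A\to\mathsf{f}_A\otimes\bar M$, carries the Kleisli multiplication $\beta\bullet\alpha=(\mathrm{id}\otimes\mu)\circ(\beta\otimes\mathrm{id}_{\bar M})\circ\alpha$ with unit $\mathsf{f}_A\simeq\mathsf{f}_A\otimes\bar O\xrightarrow{\mathrm{id}\otimes\eta}\mathsf{f}_A\otimes\bar M$. *)

theory Defs
  imports "HOL-Algebra.Group"
begin

section \<open>Categories and functors\<close>

record ('o, 'm) cat =
  ob :: "'o set"
  ar :: "'m set"
  dm :: "'m \<Rightarrow> 'o"
  cd :: "'m \<Rightarrow> 'o"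
  idn :: "'o \<Rightarrow> 'm"
  cmp :: "'m \<Rightarrow> 'm \<Rightarrow> 'm"  (infixl "\<cdot>\<index>" 70)

definition homs :: "('o, 'm, 'e) cat_scheme \<Rightarrow> 'o \<Rightarrow> 'o \<Rightarrow> 'm set" where
  "homs C a b = {f \<in> ar C. dm C f = a \<and> cd C f = b}"

locale category =
  fixes C :: "('o, 'm, 'e) cat_scheme" (structure)
  assumes dm_ob: "f \<in> ar C \<Longrightarrow> dm C f \<in> ob C"
    and cd_ob: "f \<in> ar C \<Longrightarrow> cd C f \<in> ob C"
    and idn_homs: "a \<in> ob C \<Longrightarrow> idn C a \<in> homs C a a"
    and cmp_homs: "f \<in> homs C a b \<Longrightarrow> g \<in> homs C b c \<Longrightarrow> g \<cdot> f \<in> homs C a c"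
    and idn_right: "f \<in> homs C a b \<Longrightarrow> f \<cdot> idn C a = f"
    and idn_left: "f \<in> homs C a b \<Longrightarrow> idn C b \<cdot> f = f"
    and cmp_assoc: "f \<in> homs C a b \<Longrightarrow> g \<in> homs C b c \<Longrightarrow> h \<in> homs C c d \<Longrightarrow>
          h \<cdot> (g \<cdot> f) = (h \<cdot> g) \<cdot> f"

record ('o1, 'm1, 'o2, 'm2) func =
  fo :: "'o1 \<Rightarrow> 'o2"
  fm :: "'m1 \<Rightarrow> 'm2"

locale cat_functor = A: category A + B: category B
  for A :: "('o1, 'm1, 'e1) cat_scheme" and B :: "('o2, 'm2, 'e2) cat_scheme" +
  fixes F :: "('o1, 'm1, 'o2, 'm2) func"
  assumes fo_ob: "a \<in> ob A \<Longrightarrow> fo F a \<in> ob B"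
    and fm_homs: "f \<in> homs A a b \<Longrightarrow> fm F f \<in> homs B (fo F a) (fo F b)"
    and fm_idn: "a \<in> ob A \<Longrightarrow> fm F (idn A a) = idn B (fo F a)"
    and fm_cmp: "f \<in> homs A a b \<Longrightarrow> g \<in> homs A b c \<Longrightarrow>
          fm F (g \<cdot>\<^bsub>A\<^esub> f) = fm F g \<cdot>\<^bsub>B\<^esub> fm F f"

definition id_func :: "('o, 'm, 'o, 'm) func" where
  "id_func = \<lparr>fo = \<lambda>a. a, fm = \<lambda>f. f\<rparr>"

definition comp_func ::
  "('o2, 'm2, 'o3, 'm3) func \<Rightarrow> ('o1, 'm1, 'o2, 'm2) func \<Rightarrow> ('o1, 'm1, 'o3, 'm3) func" where
  "comp_func G F = \<lparr>fo = \<lambda>a. fo G (fo F a), fm = \<lambda>f. fm G (fm F f)\<rparr>"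

text \<open>Functors are total functions here, so they are compared on the objects and arrows
  of their domain only.\<close>

definition same_func ::
  "('o1, 'm1, 'e1) cat_scheme \<Rightarrow> ('o1, 'm1, 'o2, 'm2) func \<Rightarrow> ('o1, 'm1, 'o2, 'm2) func \<Rightarrow> bool" where
  "same_func A F G \<longleftrightarrow> (\<forall>a\<in>ob A. fo F a = fo G a) \<and> (\<forall>f\<in>ar A. fm F f = fm G f)"

definition op_cat :: "('o, 'm, 'e) cat_scheme \<Rightarrow> ('o, 'm) cat" where
  "op_cat C = \<lparr>ob = ob C, ar = ar C, dm = cd C, cd = dm C, idn = idn C, cmp = \<lambda>g f. f \<cdot>\<^bsub>C\<^esub> g\<rparr>"

definition full_subcat :: "('o, 'm, 'e) cat_scheme \<Rightarrow> 'o set \<Rightarrow> ('o, 'm) cat" where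
  "full_subcat C S = \<lparr>ob = ob C \<inter> S, ar = {f \<in> ar C. dm C f \<in> S \<and> cd C f \<in> S},
     dm = dm C, cd = cd C, idn = idn C, cmp = cmp C\<rparr>"

definition iso_arrow :: "('o, 'm, 'e) cat_scheme \<Rightarrow> 'm \<Rightarrow> bool" where
  "iso_arrow C f \<longleftrightarrow> f \<in> ar C \<and> (\<exists>g \<in> homs C (cd C f) (dm C f).
     g \<cdot>\<^bsub>C\<^esub> f = idn C (dm C f) \<and> f \<cdot>\<^bsub>C\<^esub> g = idn C (cd C f))"

definition natural_iso ::
  "('o1, 'm1, 'e1) cat_scheme \<Rightarrow> ('o2, 'm2, 'e2) cat_scheme \<Rightarrow>
   ('o1, 'm1, 'o2, 'm2) func \<Rightarrow> ('o1, 'm1, 'o2, 'm2) func \<Rightarrow> ('o1 \<Rightarrow> 'm2) \<Rightarrow> bool" where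
  "natural_iso A B F G \<theta> \<longleftrightarrow> cat_functor A B F \<and> cat_functor A B G \<and>
     (\<forall>a\<in>ob A. \<theta> a \<in> homs B (fo F a) (fo G a) \<and> iso_arrow B (\<theta> a)) \<and>
     (\<forall>f\<in>ar A. \<theta> (cd A f) \<cdot>\<^bsub>B\<^esub> fm F f = fm G f \<cdot>\<^bsub>B\<^esub> \<theta> (dm A f))"

text \<open>A category whose arrows are labels \<open>t\<close> tagged with their domain and codomain;
  \<open>K a t' t\<close> is the label of the composite of \<open>t\<close>, starting at \<open>a\<close>, followed by \<open>t'\<close>.\<close>

definition tagged_cat ::
  "'o set \<Rightarrow> ('o \<Rightarrow> 'o \<Rightarrow> 't set) \<Rightarrow> ('o \<Rightarrow> 't) \<Rightarrow> ('o \<Rightarrow> 't \<Rightarrow> 't \<Rightarrow> 't) \<Rightarrow> ('o, 'o \<times> 't \<times> 'o) cat" where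
  "tagged_cat Obs H I K =
     \<lparr>ob = Obs, ar = {(a, t, b). a \<in> Obs \<and> b \<in> Obs \<and> t \<in> H a b},
      dm = \<lambda>(a, t, b). a, cd = \<lambda>(a, t, b). b, idn = \<lambda>a. (a, I a, a),
      cmp = \<lambda>(_, t', c) (a, t, _). (a, K a t' t, c)\<rparr>"


section \<open>Finite limits and chosen pullbacks\<close>

definition cone ::
  "('j, 'k) cat \<Rightarrow> ('o, 'm, 'e) cat_scheme \<Rightarrow> ('j, 'k, 'o, 'm) func \<Rightarrow> 'o \<Rightarrow> ('j \<Rightarrow> 'm) \<Rightarrow> bool" where
  "cone J C D N l \<longleftrightarrow> N \<in> ob C \<and> (\<forall>j\<in>ob J. l j \<in> homs C N (fo D j)) \<and>
     (\<forall>u\<in>ar J. fm D u \<cdot>\<^bsub>C\<^esub> l (dm J u) = l (cd J u))"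

definition limit_cone ::
  "('j, 'k) cat \<Rightarrow> ('o, 'm, 'e) cat_scheme \<Rightarrow> ('j, 'k, 'o, 'm) func \<Rightarrow> 'o \<Rightarrow> ('j \<Rightarrow> 'm) \<Rightarrow> bool" where
  "limit_cone J C D N l \<longleftrightarrow> cone J C D N l \<and>
     (\<forall>N' l'. cone J C D N' l' \<longrightarrow> (\<exists>!h. h \<in> homs C N' N \<and> (\<forall>j\<in>ob J. l j \<cdot>\<^bsub>C\<^esub> h = l' j)))"

text \<open>Every finite category is isomorphic to one with natural numbers as objects and arrows,
  so these suffice as shapes.\<close>

definition finitely_complete :: "('o, 'm, 'e) cat_scheme \<Rightarrow> bool" where
  "finitely_complete C \<longleftrightarrow> (\<forall>(J :: (nat, nat) cat) D.
     finite (ob J) \<and> finite (ar J) \<and> cat_functor J C D \<longrightarrow> (\<exists>N l. limit_cone J C D N l))"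

definition is_pullback :: "('o, 'm, 'e) cat_scheme \<Rightarrow> 'm \<Rightarrow> 'm \<Rightarrow> 'm \<Rightarrow> 'm \<Rightarrow> bool" where
  "is_pullback C f g p q \<longleftrightarrow>
     p \<in> ar C \<and> q \<in> ar C \<and> dm C p = dm C q \<and> cd C p = dm C f \<and> cd C q = dm C g \<and>
     f \<cdot>\<^bsub>C\<^esub> p = g \<cdot>\<^bsub>C\<^esub> q \<and>
     (\<forall>N. \<forall>u\<in>homs C N (dm C f). \<forall>v\<in>homs C N (dm C g). f \<cdot>\<^bsub>C\<^esub> u = g \<cdot>\<^bsub>C\<^esub> v \<longrightarrow>
        (\<exists>!h. h \<in> homs C N (dm C p) \<and> p \<cdot>\<^bsub>C\<^esub> h = u \<and> q \<cdot>\<^bsub>C\<^esub> h = v))"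

text \<open>The tensor product of spans depends on a choice of pullbacks. The choice is part of the
  structure: \<open>pr1 C f g\<close> and \<open>pr2 C f g\<close> are the projections of the chosen pullback of
  \<open>f\<close> and \<open>g\<close> to the domains of \<open>f\<close> and \<open>g\<close>.\<close>

record ('o, 'm) pb_cat = "('o, 'm) cat" +
  pr1 :: "'m \<Rightarrow> 'm \<Rightarrow> 'm"
  pr2 :: "'m \<Rightarrow> 'm \<Rightarrow> 'm"

definition chosen_pullbacks :: "('o, 'm) pb_cat \<Rightarrow> bool" where
  "chosen_pullbacks C \<longleftrightarrow>
     (\<forall>f\<in>ar C. \<forall>g\<in>ar C. cd C f = cd C g \<longrightarrow> is_pullback C f g (pr1 C f g) (pr2 C f g))"

definition pairing :: "('o, 'm) pb_cat \<Rightarrow> 'm \<Rightarrow> 'm \<Rightarrow> 'm \<Rightarrow> 'm \<Rightarrow> 'm" where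
  "pairing C f g u v = (THE h. h \<in> homs C (dm C u) (dm C (pr1 C f g)) \<and>
     pr1 C f g \<cdot>\<^bsub>C\<^esub> h = u \<and> pr2 C f g \<cdot>\<^bsub>C\<^esub> h = v)"


section \<open>Spans over an object\<close>

text \<open>A span is the pair of its legs (left, right); its underlying object is their common
  domain. A 2-cell is a tagged arrow.\<close>

type_synonym 'm span = "'m \<times> 'm"
type_synonym 'm cell = "'m span \<times> 'm \<times> 'm span"

definition apex :: "('o, 'm) pb_cat \<Rightarrow> 'm span \<Rightarrow> 'o" where
  "apex C S = dm C (fst S)"

definition arrow :: "'m cell \<Rightarrow> 'm" where
  "arrow t = fst (snd t)"

definition span_cat :: "('o, 'm) pb_cat \<Rightarrow> 'o \<Rightarrow> ('m span, 'm cell) cat" where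
  "span_cat C X = tagged_cat
     {(x, x'). x \<in> ar C \<and> x' \<in> ar C \<and> dm C x = dm C x' \<and> cd C x = X \<and> cd C x' = X}
     (\<lambda>S T. {t \<in> homs C (apex C S) (apex C T). fst T \<cdot>\<^bsub>C\<^esub> t = fst S \<and> snd T \<cdot>\<^bsub>C\<^esub> t = snd S})
     (\<lambda>S. idn C (apex C S)) (\<lambda>_. cmp C)"

text \<open>The tensor product \<open>Y \<otimes> X\<close> has the pullback of the left leg of \<open>Y\<close> and the right leg of
  \<open>X\<close> as underlying object.\<close>

definition tens_pr1 :: "('o, 'm) pb_cat \<Rightarrow> 'm span \<Rightarrow> 'm span \<Rightarrow> 'm" where
  "tens_pr1 C Y X = pr1 C (fst Y) (snd X)"

definition tens_pr2 :: "('o, 'm) pb_cat \<Rightarrow> 'm span \<Rightarrow> 'm span \<Rightarrow> 'm" where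
  "tens_pr2 C Y X = pr2 C (fst Y) (snd X)"

definition tens_pair :: "('o, 'm) pb_cat \<Rightarrow> 'm span \<Rightarrow> 'm span \<Rightarrow> 'm \<Rightarrow> 'm \<Rightarrow> 'm" where
  "tens_pair C Y X u v = pairing C (fst Y) (snd X) u v"

definition tens_ob :: "('o, 'm) pb_cat \<Rightarrow> 'm span \<Rightarrow> 'm span \<Rightarrow> 'm span" where
  "tens_ob C Y X = (fst X \<cdot>\<^bsub>C\<^esub> tens_pr2 C Y X, snd Y \<cdot>\<^bsub>C\<^esub> tens_pr1 C Y X)"

definition tens :: "('o, 'm) pb_cat \<Rightarrow> 'm cell \<Rightarrow> 'm cell \<Rightarrow> 'm cell" where
  "tens C = (\<lambda>(Y, s, Y') (X, t, X'). (tens_ob C Y X,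
     tens_pair C Y' X' (s \<cdot>\<^bsub>C\<^esub> tens_pr1 C Y X) (t \<cdot>\<^bsub>C\<^esub> tens_pr2 C Y X),
     tens_ob C Y' X'))"

definition unit_span :: "('o, 'm) pb_cat \<Rightarrow> 'o \<Rightarrow> 'm span" where
  "unit_span C X = (idn C X, idn C X)"

definition assoc_cell :: "('o, 'm) pb_cat \<Rightarrow> 'm span \<Rightarrow> 'm span \<Rightarrow> 'm span \<Rightarrow> 'm cell" where
  "assoc_cell C Z Y X =
     (let ZY = tens_ob C Z Y; YX = tens_ob C Y X;
          q = tens_pr1 C ZY X; r = tens_pr2 C ZY X
      in (tens_ob C ZY X,
          tens_pair C Z YX (tens_pr1 C Z Y \<cdot>\<^bsub>C\<^esub> q) (tens_pair C Y X (tens_pr2 C Z Y \<cdot>\<^bsub>C\<^esub> q) r),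
          tens_ob C Z YX))"

text \<open>The isomorphisms \<open>X \<simeq> X \<otimes> I\<close> and \<open>X \<simeq> I \<otimes> X\<close>, where \<open>I\<close> is the unit span on \<open>B\<close>.\<close>

definition runit_cell :: "('o, 'm) pb_cat \<Rightarrow> 'o \<Rightarrow> 'm span \<Rightarrow> 'm cell" where
  "runit_cell C B X = (X, tens_pair C X (unit_span C B) (idn C (apex C X)) (fst X),
     tens_ob C X (unit_span C B))"

definition lunit_cell :: "('o, 'm) pb_cat \<Rightarrow> 'o \<Rightarrow> 'm span \<Rightarrow> 'm cell" where
  "lunit_cell C B X = (X, tens_pair C (unit_span C B) X (snd X) (idn C (apex C X)),
     tens_ob C (unit_span C B) X)"

definition diag_span :: "'m \<Rightarrow> 'm span" where
  "diag_span f = (f, f)"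

definition slice :: "('o, 'm) pb_cat \<Rightarrow> 'o \<Rightarrow> ('m, 'm \<times> 'm \<times> 'm) cat" where
  "slice C X = tagged_cat {f \<in> ar C. cd C f = X}
     (\<lambda>f g. {t \<in> homs C (dm C f) (dm C g). g \<cdot>\<^bsub>C\<^esub> t = f}) (\<lambda>f. idn C (dm C f)) (\<lambda>_. cmp C)"

text \<open>The identification of the full subcategory of spans \<open>diag_span f\<close> with the slice
  category.\<close>

definition to_slice_ob :: "'m span \<Rightarrow> 'm" where
  "to_slice_ob S = fst S"

definition to_slice_ar :: "'m cell \<Rightarrow> 'm \<times> 'm \<times> 'm" where
  "to_slice_ar = (\<lambda>(S, t, T). (to_slice_ob S, t, to_slice_ob T))"


section \<open>Internal categories as monoids of spans\<close>

record ('o, 'm) internal_cat =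
  obj0 :: 'o
  obj1 :: 'o
  src :: 'm
  tgt :: 'm
  idt :: 'm
  mul :: 'm

definition mspan :: "('o, 'm) internal_cat \<Rightarrow> 'm span" where
  "mspan M = (src M, tgt M)"

definition eta_cell :: "('o, 'm) pb_cat \<Rightarrow> ('o, 'm) internal_cat \<Rightarrow> 'm cell" where
  "eta_cell C M = (unit_span C (obj0 M), idt M, mspan M)"

definition mu_cell :: "('o, 'm) pb_cat \<Rightarrow> ('o, 'm) internal_cat \<Rightarrow> 'm cell" where
  "mu_cell C M = (tens_ob C (mspan M) (mspan M), mul M, mspan M)"

abbreviation spans :: "('o, 'm) pb_cat \<Rightarrow> ('o, 'm) internal_cat \<Rightarrow> ('m span, 'm cell) cat" where
  "spans C M \<equiv> span_cat C (obj0 M)"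

definition id_mspan :: "('o, 'm) pb_cat \<Rightarrow> ('o, 'm) internal_cat \<Rightarrow> 'm cell" where
  "id_mspan C M = idn (spans C M) (mspan M)"

locale internal_category =
  fixes C :: "('o, 'm) pb_cat" and M :: "('o, 'm) internal_cat"
  assumes obj0: "obj0 M \<in> ob C"
    and obj1: "obj1 M \<in> ob C"
    and src: "src M \<in> homs C (obj1 M) (obj0 M)"
    and tgt: "tgt M \<in> homs C (obj1 M) (obj0 M)"
    and eta: "eta_cell C M \<in> ar (spans C M)"
    and mu: "mu_cell C M \<in> ar (spans C M)"
    and mu_assoc: "mu_cell C M \<cdot>\<^bsub>spans C M\<^esub> tens C (mu_cell C M) (id_mspan C M) =
      mu_cell C M \<cdot>\<^bsub>spans C M\<^esub> tens C (id_mspan C M) (mu_cell C M)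
        \<cdot>\<^bsub>spans C M\<^esub> assoc_cell C (mspan M) (mspan M) (mspan M)"
    and mu_lunit: "mu_cell C M \<cdot>\<^bsub>spans C M\<^esub> tens C (eta_cell C M) (id_mspan C M)
        \<cdot>\<^bsub>spans C M\<^esub> lunit_cell C (obj0 M) (mspan M) = id_mspan C M"
    and mu_runit: "mu_cell C M \<cdot>\<^bsub>spans C M\<^esub> tens C (id_mspan C M) (eta_cell C M)
        \<cdot>\<^bsub>spans C M\<^esub> runit_cell C (obj0 M) (mspan M) = id_mspan C M"


section \<open>The categories Conv and End\<close>

definition fM :: "('o, 'm) pb_cat \<Rightarrow> ('o, 'm) internal_cat \<Rightarrow> 'm \<Rightarrow> 'm span" where
  "fM C M f = tens_ob C (diag_span f) (mspan M)"

definition piM :: "('o, 'm) pb_cat \<Rightarrow> ('o, 'm) internal_cat \<Rightarrow> 'm \<Rightarrow> 'm cell" where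
  "piM C M f = (fM C M f, tens_pr2 C (diag_span f) (mspan M), mspan M)"

definition pair_cell ::
  "('o, 'm) pb_cat \<Rightarrow> ('o, 'm) internal_cat \<Rightarrow> 'm \<Rightarrow> 'm cell \<Rightarrow> 'm cell \<Rightarrow> 'm cell" where
  "pair_cell C M f \<xi> \<upsilon> =
     (diag_span f, tens_pair C (diag_span f) (mspan M) (arrow \<xi>) (arrow \<upsilon>), fM C M f)"

text \<open>In the next two definitions the domain of \<open>\<alpha>\<close> is \<open>diag_span f\<close>, and \<open>f\<close> is recovered
  from it.\<close>

definition tilde :: "('o, 'm) pb_cat \<Rightarrow> ('o, 'm) internal_cat \<Rightarrow> 'm cell \<Rightarrow> 'm cell" where
  "tilde C M \<alpha> = (let f = to_slice_ob (dm (spans C M) \<alpha>)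
     in pair_cell C M f (idn (spans C M) (diag_span f)) \<alpha>)"

definition bar :: "('o, 'm) pb_cat \<Rightarrow> ('o, 'm) internal_cat \<Rightarrow> 'm cell \<Rightarrow> 'm cell" where
  "bar C M \<alpha> = (let f = to_slice_ob (dm (spans C M) \<alpha>) in piM C M f \<cdot>\<^bsub>spans C M\<^esub> \<alpha>)"

definition Conv ::
  "('o, 'm) pb_cat \<Rightarrow> ('o, 'm) internal_cat \<Rightarrow> ('m cell, 'm cell \<times> 'm cell \<times> 'm cell) cat" where
  "Conv C M = tagged_cat
     {\<alpha>. \<exists>f \<in> ob (slice C (obj0 M)). \<alpha> \<in> homs (spans C M) (diag_span f) (mspan M)}
     (\<lambda>\<alpha> \<beta>. {\<phi> \<in> homs (spans C M) (dm (spans C M) \<alpha>) (dm (spans C M) \<beta>).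
        \<beta> \<cdot>\<^bsub>spans C M\<^esub> \<phi> = \<alpha>})
     (\<lambda>\<alpha>. idn (spans C M) (dm (spans C M) \<alpha>)) (\<lambda>_. cmp (spans C M))"

definition P_fun :: "('o, 'm) pb_cat \<Rightarrow> ('o, 'm) internal_cat \<Rightarrow>
    ('m cell, 'm cell \<times> 'm cell \<times> 'm cell, 'm, 'm \<times> 'm \<times> 'm) func" where
  "P_fun C M = \<lparr>fo = \<lambda>\<alpha>. to_slice_ob (dm (spans C M) \<alpha>), fm = \<lambda>(\<alpha>, \<phi>, \<beta>). to_slice_ar \<phi>\<rparr>"

definition EndM :: "('o, 'm) pb_cat \<Rightarrow> ('o, 'm) internal_cat \<Rightarrow>
    ('m cell, 'm cell \<times> ('m cell \<times> 'm cell) \<times> 'm cell) cat" where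
  "EndM C M = tagged_cat
     {\<alpha>. \<exists>f \<in> ob (slice C (obj0 M)). \<alpha> \<in> homs (spans C M) (diag_span f) (fM C M f)}
     (\<lambda>\<alpha> \<beta>. {(\<sigma>, \<tau>). \<sigma> \<in> homs (spans C M) (dm (spans C M) \<alpha>) (dm (spans C M) \<beta>) \<and>
        \<tau> \<in> homs (spans C M) (dm (spans C M) \<alpha>) (dm (spans C M) \<beta>) \<and>
        \<beta> \<cdot>\<^bsub>spans C M\<^esub> \<sigma> = tens C \<tau> (id_mspan C M) \<cdot>\<^bsub>spans C M\<^esub> \<alpha>})
     (\<lambda>\<alpha>. (idn (spans C M) (dm (spans C M) \<alpha>), idn (spans C M) (dm (spans C M) \<alpha>)))
     (\<lambda>_ (\<sigma>', \<tau>') (\<sigma>, \<tau>). (\<sigma>' \<cdot>\<^bsub>spans C M\<^esub> \<sigma>, \<tau>' \<cdot>\<^bsub>spans C M\<^esub> \<tau>))"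

definition simply_presented :: "('o, 'm) pb_cat \<Rightarrow> ('o, 'm) internal_cat \<Rightarrow> 'm cell \<Rightarrow> bool" where
  "simply_presented C M \<alpha> \<longleftrightarrow> (let f = to_slice_ob (dm (spans C M) \<alpha>)
     in \<alpha> = pair_cell C M f (idn (spans C M) (diag_span f)) (bar C M \<alpha>))"

definition spEnd :: "('o, 'm) pb_cat \<Rightarrow> ('o, 'm) internal_cat \<Rightarrow>
    ('m cell, 'm cell \<times> ('m cell \<times> 'm cell) \<times> 'm cell) cat" where
  "spEnd C M = full_subcat (EndM C M) {\<alpha>. simply_presented C M \<alpha>}"

definition Q_fun :: "('o, 'm) pb_cat \<Rightarrow> ('o, 'm) internal_cat \<Rightarrow>
    ('m cell, 'm cell \<times> ('m cell \<times> 'm cell) \<times> 'm cell, 'm, 'm \<times> 'm \<times> 'm) func" where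
  "Q_fun C M = \<lparr>fo = \<lambda>\<alpha>. to_slice_ob (dm (spans C M) \<alpha>), fm = \<lambda>(\<alpha>, (\<sigma>, \<tau>), \<beta>). to_slice_ar \<sigma>\<rparr>"


section \<open>Sets, monoids and discrete fibrations\<close>

definition set_cat :: "('x set, 'x set \<times> ('x \<Rightarrow> 'x) \<times> 'x set) cat" where
  "set_cat = tagged_cat UNIV (\<lambda>X Y. X \<rightarrow>\<^sub>E Y) (\<lambda>X. \<lambda>x\<in>X. x) compose"

definition mon_cat :: "('x monoid, 'x monoid \<times> ('x \<Rightarrow> 'x) \<times> 'x monoid) cat" where
  "mon_cat = tagged_cat {G. monoid G}
     (\<lambda>G H. {h \<in> hom G H \<inter> extensional (carrier G). h \<one>\<^bsub>G\<^esub> = \<one>\<^bsub>H\<^esub>})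
     (\<lambda>G. \<lambda>x\<in>carrier G. x) (\<lambda>G. compose (carrier G))"

definition forget :: "('x monoid, 'x monoid \<times> ('x \<Rightarrow> 'x) \<times> 'x monoid,
    'x set, 'x set \<times> ('x \<Rightarrow> 'x) \<times> 'x set) func" where
  "forget = \<lparr>fo = carrier, fm = \<lambda>(G, h, H). (carrier G, h, carrier H)\<rparr>"

text \<open>\<open>F\<close> factors through the forgetful functor from monoids to sets, by a functor that sends
  each object \<open>a\<close> to the monoid \<open>m a\<close>.\<close>

definition factors_over_Mon :: "('o, 'm, 'e) cat_scheme \<Rightarrow>
    ('o, 'm, 'x set, 'x set \<times> ('x \<Rightarrow> 'x) \<times> 'x set) func \<Rightarrow> ('o \<Rightarrow> 'x monoid) \<Rightarrow> bool" where
  "factors_over_Mon A F m \<longleftrightarrow> (\<exists>K. cat_functor A mon_cat K \<and>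
     same_func A (comp_func forget K) F \<and> (\<forall>a\<in>ob A. fo K a = m a))"

locale discrete_fibration = cat_functor X A P
  for X :: "('o1, 'm1, 'e1) cat_scheme" and A :: "('o2, 'm2, 'e2) cat_scheme"
    and P :: "('o1, 'm1, 'o2, 'm2) func" +
  assumes unique_lift: "x \<in> ob X \<Longrightarrow> f \<in> ar A \<Longrightarrow> cd A f = fo P x \<Longrightarrow>
    \<exists>!g. g \<in> ar X \<and> cd X g = x \<and> fm P g = f"

definition fibre :: "('o1, 'm1, 'e1) cat_scheme \<Rightarrow> ('o1, 'm1, 'o2, 'm2) func \<Rightarrow> 'o2 \<Rightarrow> 'o1 set" where
  "fibre X P a = {x \<in> ob X. fo P x = a}"

text \<open>The change of base functor, contravariant in \<open>A\<close>: a functor from \<open>op_cat A\<close> to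
  \<open>set_cat\<close>.\<close>

definition base_change :: "('o1, 'm1, 'e1) cat_scheme \<Rightarrow> ('o2, 'm2, 'e2) cat_scheme \<Rightarrow>
    ('o1, 'm1, 'o2, 'm2) func \<Rightarrow> ('o2, 'm2, 'o1 set, 'o1 set \<times> ('o1 \<Rightarrow> 'o1) \<times> 'o1 set) func" where
  "base_change X A P = \<lparr>fo = fibre X P,
     fm = \<lambda>f. (fibre X P (cd A f),
       \<lambda>x\<in>fibre X P (cd A f). dm X (THE g. g \<in> ar X \<and> cd X g = x \<and> fm P g = f),
       fibre X P (dm A f))\<rparr>"

definition cartesian_arrow :: "('o1, 'm1, 'e1) cat_scheme \<Rightarrow> ('o2, 'm2, 'e2) cat_scheme \<Rightarrow>
    ('o1, 'm1, 'o2, 'm2) func \<Rightarrow> 'm1 \<Rightarrow> bool" where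
  "cartesian_arrow X A P g \<longleftrightarrow> g \<in> ar X \<and>
     (\<forall>h\<in>ar X. \<forall>u\<in>homs A (fo P (dm X h)) (fo P (dm X g)).
        cd X h = cd X g \<and> fm P g \<cdot>\<^bsub>A\<^esub> u = fm P h \<longrightarrow>
        (\<exists>!k. k \<in> homs X (dm X h) (dm X g) \<and> g \<cdot>\<^bsub>X\<^esub> k = h \<and> fm P k = u))"

text \<open>\<open>E\<close> is an isomorphism from \<open>X\<close> to \<open>Y\<close> over \<open>A\<close> with inverse \<open>L\<close>, and both preserve
  cartesian arrows.\<close>

definition cartesian_iso :: "('o1, 'm1, 'e1) cat_scheme \<Rightarrow> ('o2, 'm2, 'e2) cat_scheme \<Rightarrow>
    ('o3, 'm3, 'e3) cat_scheme \<Rightarrow> ('o1, 'm1, 'o3, 'm3) func \<Rightarrow> ('o2, 'm2, 'o3, 'm3) func \<Rightarrow>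
    ('o1, 'm1, 'o2, 'm2) func \<Rightarrow> ('o2, 'm2, 'o1, 'm1) func \<Rightarrow> bool" where
  "cartesian_iso X Y A P Q E L \<longleftrightarrow> cat_functor X Y E \<and> cat_functor Y X L \<and>
     same_func X (comp_func L E) id_func \<and> same_func Y (comp_func E L) id_func \<and>
     same_func X (comp_func Q E) P \<and> same_func Y (comp_func P L) Q \<and>
     (\<forall>g. cartesian_arrow X A P g \<longrightarrow> cartesian_arrow Y A Q (fm E g)) \<and>
     (\<forall>g. cartesian_arrow Y A Q g \<longrightarrow> cartesian_arrow X A P (fm L g))"

definition diagonal :: "('o, 'm) pb_cat \<Rightarrow> 'm \<Rightarrow> 'm cell" where
  "diagonal C f = (diag_span f,
     tens_pair C (diag_span f) (diag_span f) (idn C (dm C f)) (idn C (dm C f)),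
     tens_ob C (diag_span f) (diag_span f))"

definition conv_monoid :: "('o, 'm) pb_cat \<Rightarrow> ('o, 'm) internal_cat \<Rightarrow> 'm \<Rightarrow> 'm cell monoid" where
  "conv_monoid C M f =
     \<lparr>carrier = homs (spans C M) (diag_span f) (mspan M),
      mult = \<lambda>\<phi> \<psi>. mu_cell C M \<cdot>\<^bsub>spans C M\<^esub> tens C \<phi> \<psi> \<cdot>\<^bsub>spans C M\<^esub> diagonal C f,
      one = eta_cell C M \<cdot>\<^bsub>spans C M\<^esub> (diag_span f, f, unit_span C (obj0 M))\<rparr>"

definition kleisli_monoid :: "('o, 'm) pb_cat \<Rightarrow> ('o, 'm) internal_cat \<Rightarrow> 'm \<Rightarrow> 'm cell monoid" where
  "kleisli_monoid C M f =
     \<lparr>carrier = {\<alpha> \<in> homs (spans C M) (diag_span f) (fM C M f). simply_presented C M \<alpha>},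
      mult = \<lambda>\<beta> \<alpha>. tens C (idn (spans C M) (diag_span f)) (mu_cell C M)
        \<cdot>\<^bsub>spans C M\<^esub> assoc_cell C (diag_span f) (mspan M) (mspan M)
        \<cdot>\<^bsub>spans C M\<^esub> tens C \<beta> (id_mspan C M) \<cdot>\<^bsub>spans C M\<^esub> \<alpha>,
      one = tens C (idn (spans C M) (diag_span f)) (eta_cell C M)
        \<cdot>\<^bsub>spans C M\<^esub> runit_cell C (obj0 M) (diag_span f)\<rparr>"

end

theory Submission
  imports Defs
begin

text \<open>
  A 2-cell from the span with both legs \<open>f\<close> to the span of the internal category \<open>M\<close> is nothing
  but a generalized arrow \<open>p\<close> of \<open>M\<close> whose domain and codomain are both \<open>f\<close>: an internal loop at
  \<open>f\<close>. Objects of \<open>Conv\<close> are therefore loops, and an arrow of \<open>Conv\<close> into \<open>q\<close> is a map \<open>t\<close> of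
  the base together with the loop \<open>q \<circ> t\<close>; the source is determined by \<open>t\<close> and \<open>q\<close>, which is the
  discrete fibration property. Loops at \<open>f\<close> can be composed in \<open>M\<close>, and the axioms of \<open>M\<close> make
  them a monoid (\<open>loop_mult\<close>, \<open>mult_assoc\<close>, \<open>mult_one_left\<close>, \<open>mult_one_right\<close>). Precomposition
  with \<open>t\<close> respects composition by uniqueness of maps into a pullback, so change of base consists
  of monoid homomorphisms (\<open>mult_loops_cmp\<close>). The convolution product is exactly this
  composition (\<open>conv_monoid_simps\<close>).

  The simply presented endomorphisms are the graphs \<open>\<langle>id, p\<rangle>\<close> of loops \<open>p\<close>
  (\<open>simply_presented_iff\<close>). Comparing the two pullback projections in the square that defines an
  arrow \<open>(\<sigma>, \<tau>)\<close> between two graphs gives \<open>\<sigma> = \<tau>\<close> from the first and the defining equation of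
  \<open>Conv\<close> from the second (\<open>End_square_iff\<close>). Thus taking graphs is an isomorphism of categories
  over the slice, and the Kleisli product of the graphs of \<open>p\<close> and \<open>q\<close> is the graph of their
  composite (\<open>kleisli_monoid_simps\<close>).

  What remains holds for any discrete fibration: every arrow is cartesian, so every isomorphism
  over the base is a cartesian isomorphism (\<open>cartesian_isoI\<close>), and it induces a natural
  isomorphism of the change of base functors (\<open>natural_iso_base_change\<close>).

  All equations between 2-cells out of tensor products are checked on generalized elements: an
  element of \<open>Y \<otimes> X\<close> is a pair of elements that agree over the middle object, and
  \<open>tens_element\<close> and \<open>assoc_element\<close> say how the structural maps act on such pairs.
\<close>

section \<open>Categories\<close>

context category
begin

lemma idn_simps [simp]:
  assumes "a \<in> ob C"
  shows "idn C a \<in> ar C" "dm C (idn C a) = a" "cd C (idn C a) = a"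
  using idn_homs[OF assms] by (auto simp: homs_def)

lemma cmp_simps [simp]:
  assumes "f \<in> ar C" "g \<in> ar C" "cd C f = dm C g"
  shows "g \<cdot> f \<in> ar C" "dm C (g \<cdot> f) = dm C f" "cd C (g \<cdot> f) = cd C g"
  using cmp_homs[of f "dm C f" "cd C f" g "cd C g"] assms by (auto simp: homs_def)

lemma idn_right_ar [simp]: "f \<in> ar C \<Longrightarrow> dm C f = a \<Longrightarrow> f \<cdot> idn C a = f"
  using idn_right[of f a "cd C f"] by (simp add: homs_def)

lemma idn_left_ar [simp]: "f \<in> ar C \<Longrightarrow> cd C f = b \<Longrightarrow> idn C b \<cdot> f = f"
  using idn_left[of f "dm C f" b] by (simp add: homs_def)

lemma assoc_ar [simp]:
  "f \<in> ar C \<Longrightarrow> g \<in> ar C \<Longrightarrow> h \<in> ar C \<Longrightarrow> cd C f = dm C g \<Longrightarrow> cd C g = dm C h \<Longrightarrow>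
    (h \<cdot> g) \<cdot> f = h \<cdot> (g \<cdot> f)"
  using cmp_assoc[of f "dm C f" "cd C f" g "cd C g" h "cd C h"] by (simp add: homs_def)

lemma dm_cd_ob [simp]: "f \<in> ar C \<Longrightarrow> dm C f \<in> ob C" "f \<in> ar C \<Longrightarrow> cd C f \<in> ob C"
  by (auto simp: dm_ob cd_ob)

lemma category_op_cat: "category (op_cat C)"
  by unfold_locales (auto simp: op_cat_def homs_def)

lemma category_full_subcat: "category (full_subcat C S)"
  by unfold_locales (auto simp: full_subcat_def homs_def)

end

lemma op_cat_simps [simp]:
  "ob (op_cat C) = ob C" "ar (op_cat C) = ar C" "dm (op_cat C) = cd C" "cd (op_cat C) = dm C"
  "idn (op_cat C) = idn C" "g \<cdot>\<^bsub>op_cat C\<^esub> f = f \<cdot>\<^bsub>C\<^esub> g"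
  by (simp_all add: op_cat_def)

lemma full_subcat_simps [simp]:
  "ob (full_subcat C S) = ob C \<inter> S"
  "ar (full_subcat C S) = {f \<in> ar C. dm C f \<in> S \<and> cd C f \<in> S}"
  "dm (full_subcat C S) = dm C" "cd (full_subcat C S) = cd C"
  "idn (full_subcat C S) = idn C" "g \<cdot>\<^bsub>full_subcat C S\<^esub> f = g \<cdot>\<^bsub>C\<^esub> f"
  by (simp_all add: full_subcat_def)

lemma tagged_cat_simps [simp]:
  "ob (tagged_cat Obs H I K) = Obs"
  "(a, t, b) \<in> ar (tagged_cat Obs H I K) \<longleftrightarrow> a \<in> Obs \<and> b \<in> Obs \<and> t \<in> H a b"
  "dm (tagged_cat Obs H I K) (a, t, b) = a"
  "cd (tagged_cat Obs H I K) (a, t, b) = b"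
  "idn (tagged_cat Obs H I K) a = (a, I a, a)"
  "(b', t', c) \<cdot>\<^bsub>tagged_cat Obs H I K\<^esub> (a, t, b) = (a, K a t' t, c)"
  by (simp_all add: tagged_cat_def)

lemma mem_homs_tagged_cat [simp]:
  "(a', t, b') \<in> homs (tagged_cat Obs H I K) a b \<longleftrightarrow>
    a' = a \<and> b' = b \<and> a \<in> Obs \<and> b \<in> Obs \<and> t \<in> H a b"
  by (auto simp: homs_def)

lemma mem_homs_tagged_catD:
  assumes "f \<in> homs (tagged_cat Obs H I K) a b"
  obtains t where "f = (a, t, b)" "a \<in> Obs" "b \<in> Obs" "t \<in> H a b"
  using assms by (cases f) auto

text \<open>Since arrows carry their domain and codomain, only the label operations have to be checked.\<close>

lemma category_tagged_cat:
  assumes I: "\<And>a. a \<in> Obs \<Longrightarrow> I a \<in> H a a"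
    and K: "\<And>a b c t t'. a \<in> Obs \<Longrightarrow> b \<in> Obs \<Longrightarrow> c \<in> Obs \<Longrightarrow> t \<in> H a b \<Longrightarrow> t' \<in> H b c \<Longrightarrow> K a t' t \<in> H a c"
    and unit: "\<And>a b t. a \<in> Obs \<Longrightarrow> b \<in> Obs \<Longrightarrow> t \<in> H a b \<Longrightarrow> K a t (I a) = t"
      "\<And>a b t. a \<in> Obs \<Longrightarrow> b \<in> Obs \<Longrightarrow> t \<in> H a b \<Longrightarrow> K a (I b) t = t"
    and assoc: "\<And>a b c d t t' t''. a \<in> Obs \<Longrightarrow> b \<in> Obs \<Longrightarrow> c \<in> Obs \<Longrightarrow> d \<in> Obs \<Longrightarrow>
      t \<in> H a b \<Longrightarrow> t' \<in> H b c \<Longrightarrow> t'' \<in> H c d \<Longrightarrow> K a t'' (K a t' t) = K a (K b t'' t') t"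
  shows "category (tagged_cat Obs H I K)"
proof
  let ?T = "tagged_cat Obs H I K"
  fix f assume "f \<in> ar ?T"
  then show "dm ?T f \<in> ob ?T" "cd ?T f \<in> ob ?T" by (cases f; auto)+
next
  let ?T = "tagged_cat Obs H I K"
  fix a assume "a \<in> ob ?T"
  then show "idn ?T a \<in> homs ?T a a" using I by auto
next
  let ?T = "tagged_cat Obs H I K"
  fix f g a b c assume "f \<in> homs ?T a b" "g \<in> homs ?T b c"
  then show "g \<cdot>\<^bsub>?T\<^esub> f \<in> homs ?T a c"
    by (auto elim!: mem_homs_tagged_catD intro: K)
next
  let ?T = "tagged_cat Obs H I K"
  fix f a b assume "f \<in> homs ?T a b"
  then show "f \<cdot>\<^bsub>?T\<^esub> idn ?T a = f" "idn ?T b \<cdot>\<^bsub>?T\<^esub> f = f"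
    by (auto elim!: mem_homs_tagged_catD intro: unit)
next
  let ?T = "tagged_cat Obs H I K"
  fix f g h a b c d assume "f \<in> homs ?T a b" "g \<in> homs ?T b c" "h \<in> homs ?T c d"
  then show "h \<cdot>\<^bsub>?T\<^esub> (g \<cdot>\<^bsub>?T\<^esub> f) = (h \<cdot>\<^bsub>?T\<^esub> g) \<cdot>\<^bsub>?T\<^esub> f"
    by (auto elim!: mem_homs_tagged_catD intro: assoc)
qed

lemma category_set_cat: "category set_cat"
  unfolding set_cat_def
proof (rule category_tagged_cat)
  fix X Y Z :: "'x set" and s t assume "s \<in> X \<rightarrow>\<^sub>E Y" "t \<in> Y \<rightarrow>\<^sub>E Z"
  then show "compose X t s \<in> X \<rightarrow>\<^sub>E Z" by (auto simp: compose_def PiE_def Pi_def)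
next
  fix X Y Z W :: "'x set" and s t u assume "s \<in> X \<rightarrow>\<^sub>E Y"
  then show "compose X u (compose X t s) = compose X (compose Y u t) s"
    by (intro compose_assoc) auto
next
  fix X Y :: "'x set" and s assume "s \<in> X \<rightarrow>\<^sub>E Y"
  then show "compose X s (\<lambda>x\<in>X. x) = s" "compose X (\<lambda>y\<in>Y. y) s = s"
    by (auto simp: compose_def fun_eq_iff PiE_def Pi_def extensional_def)
qed auto

lemma category_mon_cat: "category mon_cat"
  unfolding mon_cat_def
proof (rule category_tagged_cat)
  fix G :: "'x monoid" assume "G \<in> {G. monoid G}"
  then show "(\<lambda>x\<in>carrier G. x) \<in> {h \<in> hom G G \<inter> extensional (carrier G). h \<one>\<^bsub>G\<^esub> = \<one>\<^bsub>G\<^esub>}"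
    by (auto simp: hom_def monoid.m_closed)
next
  fix G H K :: "'x monoid" and s t
  assume "G \<in> {G. monoid G}" "s \<in> {h \<in> hom G H \<inter> extensional (carrier G). h \<one>\<^bsub>G\<^esub> = \<one>\<^bsub>H\<^esub>}"
    "t \<in> {h \<in> hom H K \<inter> extensional (carrier H). h \<one>\<^bsub>H\<^esub> = \<one>\<^bsub>K\<^esub>}"
  then show "compose (carrier G) t s \<in> {h \<in> hom G K \<inter> extensional (carrier G). h \<one>\<^bsub>G\<^esub> = \<one>\<^bsub>K\<^esub>}"
    by (auto simp: hom_def compose_def Pi_def monoid.m_closed)
next
  fix G H K L :: "'x monoid" and s t u
  assume "s \<in> {h \<in> hom G H \<inter> extensional (carrier G). h \<one>\<^bsub>G\<^esub> = \<one>\<^bsub>H\<^esub>}"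
  then show "compose (carrier G) u (compose (carrier G) t s) = compose (carrier G) (compose (carrier H) u t) s"
    by (intro compose_assoc) (auto simp: hom_def)
next
  fix G H :: "'x monoid" and s assume "s \<in> {h \<in> hom G H \<inter> extensional (carrier G). h \<one>\<^bsub>G\<^esub> = \<one>\<^bsub>H\<^esub>}"
  then show "compose (carrier G) s (\<lambda>x\<in>carrier G. x) = s"
    "compose (carrier G) (\<lambda>y\<in>carrier H. y) s = s"
    by (auto simp: compose_def fun_eq_iff hom_def Pi_def extensional_def)
qed


section \<open>Discrete fibrations and change of base\<close>

context discrete_fibration
begin

definition lift :: "'o1 \<Rightarrow> 'm2 \<Rightarrow> 'm1" where
  "lift x u = (THE g. g \<in> ar X \<and> cd X g = x \<and> fm P g = u)"

definition reindex :: "'m2 \<Rightarrow> 'o1 \<Rightarrow> 'o1" where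
  "reindex u x = dm X (lift x u)"

lemma lift:
  assumes "u \<in> ar A" "x \<in> fibre X P (cd A u)"
  shows "lift x u \<in> ar X" "cd X (lift x u) = x" "fm P (lift x u) = u"
  using theI'[OF unique_lift[of x u]] assms unfolding lift_def fibre_def by auto

lemma fm_ar [simp]:
  assumes "g \<in> ar X"
  shows "fm P g \<in> ar A" "dm A (fm P g) = fo P (dm X g)" "cd A (fm P g) = fo P (cd X g)"
  using fm_homs[of g "dm X g" "cd X g"] assms by (auto simp: homs_def)

text \<open>Uniqueness of lifts: an arrow is determined by its codomain and its image. All later
  identifications of arrows in the total category rest on this.\<close>

lemma arrow_eqI:
  assumes "g \<in> ar X" "h \<in> ar X" "cd X g = cd X h" "fm P g = fm P h"
  shows "g = h"
proof -
  have "\<exists>!k. k \<in> ar X \<and> cd X k = cd X h \<and> fm P k = fm P h"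
    using assms by (intro unique_lift) auto
  then show ?thesis using assms by blast
qed

lemma reindex_eqI:
  assumes "g \<in> ar X" "cd X g = x" "fm P g = u"
  shows "reindex u x = dm X g"
proof -
  have "u \<in> ar A" "x \<in> fibre X P (cd A u)" using assms by (auto simp: fibre_def)
  from arrow_eqI[OF lift(1)[OF this] assms(1)] lift[OF this] assms show ?thesis
    by (simp add: reindex_def)
qed

lemma reindex_fibre:
  assumes "u \<in> ar A" "x \<in> fibre X P (cd A u)"
  shows "reindex u x \<in> fibre X P (dm A u)"
  using lift[OF assms] fm_ar(2)[of "lift x u"] by (auto simp: reindex_def fibre_def)

lemma fm_base_change:
  "fm (base_change X A P) u =
    (fibre X P (cd A u), \<lambda>x\<in>fibre X P (cd A u). reindex u x, fibre X P (dm A u))"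
  by (simp add: base_change_def reindex_def lift_def)

lemma fo_base_change [simp]: "fo (base_change X A P) = fibre X P"
  by (simp add: base_change_def)

lemma reindex_idn:
  assumes "x \<in> fibre X P a"
  shows "reindex (idn A a) x = x"
proof -
  have "x \<in> ob X" "fo P x = a" using assms by (auto simp: fibre_def)
  then show ?thesis using reindex_eqI[of "idn X x"] fm_idn by auto
qed

lemma reindex_cmp:
  assumes "u \<in> ar A" "v \<in> ar A" "cd A u = dm A v" "x \<in> fibre X P (cd A v)"
  shows "reindex (v \<cdot>\<^bsub>A\<^esub> u) x = reindex u (reindex v x)"
proof -
  define g where "g = lift x v"
  define h where "h = lift (dm X g) u"
  have g: "g \<in> ar X" "cd X g = x" "fm P g = v"
    unfolding g_def by (rule lift[OF assms(2,4)])+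
  have "dm X g \<in> fibre X P (cd A u)"
    using reindex_fibre[OF assms(2,4)] assms(3) by (simp add: reindex_def g_def)
  from lift[OF assms(1) this] have h: "h \<in> ar X" "cd X h = dm X g" "fm P h = u"
    unfolding h_def by blast+
  have "fm P (g \<cdot>\<^bsub>X\<^esub> h) = v \<cdot>\<^bsub>A\<^esub> u"
    using fm_cmp[of h "dm X h" "dm X g" g "cd X g"] g h by (simp add: homs_def)
  then have "reindex (v \<cdot>\<^bsub>A\<^esub> u) x = dm X h"
    using reindex_eqI[of "g \<cdot>\<^bsub>X\<^esub> h"] g h by simp
  then show ?thesis by (simp add: reindex_def g_def h_def)
qed

text \<open>By uniqueness, the lift of a composite is the composite of the lifts, so taking domains of
  lifts is functorial.\<close>

lemma functor_base_change: "cat_functor (op_cat A) set_cat (base_change X A P)"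
proof (intro cat_functor.intro cat_functor_axioms.intro)
  show "category (op_cat A)" by (rule B.category_op_cat)
  show "category set_cat" by (rule category_set_cat)
next
  fix u a b assume "u \<in> homs (op_cat A) a b"
  then show "fm (base_change X A P) u \<in> homs set_cat (fo (base_change X A P) a) (fo (base_change X A P) b)"
    by (auto simp: fm_base_change set_cat_def homs_def reindex_fibre)
next
  fix a assume "a \<in> ob (op_cat A)"
  then show "fm (base_change X A P) (idn (op_cat A) a) = idn set_cat (fo (base_change X A P) a)"
    by (auto simp: fm_base_change set_cat_def reindex_idn)
next
  fix u v a b c assume "u \<in> homs (op_cat A) a b" "v \<in> homs (op_cat A) b c"
  then show "fm (base_change X A P) (v \<cdot>\<^bsub>op_cat A\<^esub> u) =
      fm (base_change X A P) v \<cdot>\<^bsub>set_cat\<^esub> fm (base_change X A P) u"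
    by (auto simp: fm_base_change set_cat_def homs_def compose_def fun_eq_iff reindex_fibre reindex_cmp)
qed (simp add: set_cat_def)

text \<open>Since \<open>base_change\<close> is already a functor to sets, a functor to monoids above it needs
  only the monoid structures on the fibres and the fact that reindexing preserves them.\<close>

lemma factors_over_MonI:
  assumes car: "\<And>a. a \<in> ob A \<Longrightarrow> carrier (m a) = fibre X P a"
    and mon: "\<And>a. a \<in> ob A \<Longrightarrow> monoid (m a)"
    and hom: "\<And>u. u \<in> ar A \<Longrightarrow> reindex u \<in> hom (m (cd A u)) (m (dm A u))"
    and one: "\<And>u. u \<in> ar A \<Longrightarrow> reindex u \<one>\<^bsub>m (cd A u)\<^esub> = \<one>\<^bsub>m (dm A u)\<^esub>"
  shows "factors_over_Mon (op_cat A) (base_change X A P) m"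
proof -
  define K where "K = \<lparr>fo = m,
    fm = \<lambda>u. (m (cd A u), \<lambda>x\<in>fibre X P (cd A u). reindex u x, m (dm A u))\<rparr>"
  have "cat_functor (op_cat A) mon_cat K"
  proof (intro cat_functor.intro cat_functor_axioms.intro)
    show "category (op_cat A)" by (rule B.category_op_cat)
    show "category mon_cat" by (rule category_mon_cat)
  next
    fix a assume "a \<in> ob (op_cat A)"
    then show "fo K a \<in> ob mon_cat" by (simp add: K_def mon_cat_def mon)
  next
    fix u a b assume "u \<in> homs (op_cat A) a b"
    then have u: "u \<in> ar A" "cd A u = a" "dm A u = b" by (auto simp: homs_def)
    then have ab: "a \<in> ob A" "b \<in> ob A" by auto
    show "fm K u \<in> homs mon_cat (fo K a) (fo K b)"
      using hom[OF u(1)] one[OF u(1)] mon[OF ab(1)] mon[OF ab(2)] u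
        monoid.m_closed[OF mon[OF ab(1)]] monoid.one_closed[OF mon[OF ab(1)]]
      by (auto simp: K_def mon_cat_def car[OF ab(1), symmetric] hom_def)
  next
    fix a assume "a \<in> ob (op_cat A)"
    then show "fm K (idn (op_cat A) a) = idn mon_cat (fo K a)"
      by (auto simp: K_def mon_cat_def reindex_idn car)
  next
    fix u v a b c assume "u \<in> homs (op_cat A) a b" "v \<in> homs (op_cat A) b c"
    then show "fm K (v \<cdot>\<^bsub>op_cat A\<^esub> u) = fm K v \<cdot>\<^bsub>mon_cat\<^esub> fm K u"
      by (auto simp: K_def mon_cat_def homs_def compose_def fun_eq_iff reindex_fibre reindex_cmp car)
  qed
  moreover have "same_func (op_cat A) (comp_func forget K) (base_change X A P)"
    by (auto simp: same_func_def comp_func_def forget_def K_def car fm_base_change)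
  ultimately show ?thesis
    unfolding factors_over_Mon_def by (intro exI[of _ K]) (simp add: K_def)
qed

text \<open>The lift \<open>k\<close> of \<open>u\<close> to the domain of \<open>g\<close> satisfies \<open>g \<circ> k = h\<close> because both sides
  have the same codomain and the same image. So being cartesian is no condition at all in a
  discrete fibration.\<close>

lemma cartesian_arrow_iff: "cartesian_arrow X A P g \<longleftrightarrow> g \<in> ar X"
proof (intro iffI)
  assume g: "g \<in> ar X"
  have "\<exists>!k. k \<in> homs X (dm X h) (dm X g) \<and> g \<cdot>\<^bsub>X\<^esub> k = h \<and> fm P k = u"
    if h: "h \<in> ar X" and u: "u \<in> homs A (fo P (dm X h)) (fo P (dm X g))"
      and cd: "cd X h = cd X g" and comp: "fm P g \<cdot>\<^bsub>A\<^esub> u = fm P h" for h u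
  proof -
    have "u \<in> ar A" "dm X g \<in> fibre X P (cd A u)" using u g by (auto simp: homs_def fibre_def)
    note k = lift[OF this]
    let ?k = "lift (dm X g) u"
    have "fm P (g \<cdot>\<^bsub>X\<^esub> ?k) = fm P h"
      using fm_cmp[of ?k "dm X ?k" "dm X g" g "cd X g"] k g comp by (simp add: homs_def)
    then have gk: "g \<cdot>\<^bsub>X\<^esub> ?k = h" using k g h cd by (intro arrow_eqI) auto
    then have "dm X ?k = dm X h" using k g by auto
    show ?thesis
    proof (intro ex1I[of _ ?k])
      show "?k \<in> homs X (dm X h) (dm X g) \<and> g \<cdot>\<^bsub>X\<^esub> ?k = h \<and> fm P ?k = u"
        using k gk \<open>dm X ?k = dm X h\<close> by (simp add: homs_def)
    next
      fix k' assume "k' \<in> homs X (dm X h) (dm X g) \<and> g \<cdot>\<^bsub>X\<^esub> k' = h \<and> fm P k' = u"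
      then show "k' = ?k" using k by (intro arrow_eqI) (auto simp: homs_def)
    qed
  qed
  then show "cartesian_arrow X A P g" using g by (auto simp: cartesian_arrow_def)
qed (simp add: cartesian_arrow_def)

end

lemma cartesian_isoI:
  assumes "discrete_fibration X A P" "discrete_fibration Y A Q"
    and E: "cat_functor X Y E" and L: "cat_functor Y X L"
    and "same_func X (comp_func L E) id_func" "same_func Y (comp_func E L) id_func"
    and "same_func X (comp_func Q E) P" "same_func Y (comp_func P L) Q"
  shows "cartesian_iso X Y A P Q E L"
proof -
  have "fm E g \<in> ar Y" if "g \<in> ar X" for g
    using that cat_functor.fm_homs[OF E, of g "dm X g" "cd X g"] by (simp add: homs_def)
  moreover have "fm L g \<in> ar X" if "g \<in> ar Y" for g
    using that cat_functor.fm_homs[OF L, of g "dm Y g" "cd Y g"] by (simp add: homs_def)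
  ultimately show ?thesis
    using assms unfolding cartesian_iso_def
    by (simp add: discrete_fibration.cartesian_arrow_iff)
qed

text \<open>Both total categories have objects of the same type because their change of base functors
  must have a common target \<open>set_cat\<close> to be compared.\<close>

locale cartesian_isomorphism =
  P: discrete_fibration X A P + Q: discrete_fibration Y A Q
  for X :: "('o1, 'm1, 'e1) cat_scheme" and A :: "('o3, 'm3, 'e3) cat_scheme"
    and P :: "('o1, 'm1, 'o3, 'm3) func" and Y :: "('o1, 'm2, 'e2) cat_scheme"
    and Q :: "('o1, 'm2, 'o3, 'm3) func" +
  fixes E :: "('o1, 'm1, 'o1, 'm2) func" and L :: "('o1, 'm2, 'o1, 'm1) func"
  assumes iso: "cartesian_iso X Y A P Q E L"
begin

lemma E: "cat_functor X Y E" and L: "cat_functor Y X L"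
  using iso by (auto simp: cartesian_iso_def)

lemma E_fibre: "x \<in> fibre X P a \<Longrightarrow> fo E x \<in> fibre Y Q a"
  using iso cat_functor.fo_ob[OF E]
  by (auto simp: cartesian_iso_def fibre_def same_func_def comp_func_def)

lemma L_fibre: "y \<in> fibre Y Q a \<Longrightarrow> fo L y \<in> fibre X P a"
  using iso cat_functor.fo_ob[OF L]
  by (auto simp: cartesian_iso_def fibre_def same_func_def comp_func_def)

lemma LE: "x \<in> fibre X P a \<Longrightarrow> fo L (fo E x) = x"
  and EL: "y \<in> fibre Y Q a \<Longrightarrow> fo E (fo L y) = y"
  using iso by (auto simp: cartesian_iso_def fibre_def same_func_def comp_func_def id_func_def)

text \<open>A functor over the base maps the lift of \<open>u\<close> at \<open>x\<close> to a lift of \<open>u\<close> at \<open>E x\<close>, and there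
  is only one. This is the naturality square of \<open>natural_iso_base_change\<close>.\<close>

lemma E_reindex:
  assumes "u \<in> ar A" "x \<in> fibre X P (cd A u)"
  shows "fo E (P.reindex u x) = Q.reindex u (fo E x)"
proof -
  let ?g = "P.lift x u"
  note g = P.lift[OF assms]
  have "fm E ?g \<in> homs Y (fo E (dm X ?g)) (fo E x)"
    using cat_functor.fm_homs[OF E, of ?g "dm X ?g" x] g by (simp add: homs_def)
  moreover have "fm Q (fm E ?g) = u"
    using iso g by (auto simp: cartesian_iso_def same_func_def comp_func_def)
  ultimately show ?thesis
    using Q.reindex_eqI[of "fm E ?g" "fo E x" u] by (auto simp: homs_def P.reindex_def)
qed

lemma natural_iso_base_change:
  "natural_iso (op_cat A) set_cat (base_change X A P) (base_change Y A Q)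
    (\<lambda>a. (fibre X P a, \<lambda>x\<in>fibre X P a. fo E x, fibre Y Q a))"
  unfolding natural_iso_def
proof (intro conjI ballI)
  show "cat_functor (op_cat A) set_cat (base_change X A P)" by (rule P.functor_base_change)
  show "cat_functor (op_cat A) set_cat (base_change Y A Q)" by (rule Q.functor_base_change)
next
  fix a
  show "(fibre X P a, \<lambda>x\<in>fibre X P a. fo E x, fibre Y Q a)
      \<in> homs set_cat (fo (base_change X A P) a) (fo (base_change Y A Q) a)"
    by (auto simp: set_cat_def E_fibre)
  show "iso_arrow set_cat (fibre X P a, \<lambda>x\<in>fibre X P a. fo E x, fibre Y Q a)"
    unfolding iso_arrow_def
    by (auto simp: set_cat_def E_fibre L_fibre compose_def LE EL fun_eq_iff
        intro!: bexI[of _ "(fibre Y Q a, \<lambda>y\<in>fibre Y Q a. fo L y, fibre X P a)"])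
next
  fix u assume "u \<in> ar (op_cat A)"
  then show "(fibre X P (cd (op_cat A) u), \<lambda>x\<in>fibre X P (cd (op_cat A) u). fo E x, fibre Y Q (cd (op_cat A) u))
      \<cdot>\<^bsub>set_cat\<^esub> fm (base_change X A P) u =
    fm (base_change Y A Q) u \<cdot>\<^bsub>set_cat\<^esub>
      (fibre X P (dm (op_cat A) u), \<lambda>x\<in>fibre X P (dm (op_cat A) u). fo E x, fibre Y Q (dm (op_cat A) u))"
    by (auto simp: P.fm_base_change Q.fm_base_change set_cat_def compose_def fun_eq_iff
        E_fibre P.reindex_fibre E_reindex)
qed

end


section \<open>The tensor product of spans on generalized elements\<close>

locale spans_over = category C for C :: "('o, 'm) pb_cat" (structure) +
  fixes B :: 'o
  assumes pullbacks: "chosen_pullbacks C" and B: "B \<in> ob C"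
begin

abbreviation Spans :: "('m span, 'm cell) cat" where
  "Spans \<equiv> span_cat C B"

definition span :: "'m span \<Rightarrow> bool" where
  "span S \<longleftrightarrow> S \<in> ob Spans"

definition cell :: "'m span \<Rightarrow> 'm \<Rightarrow> 'm span \<Rightarrow> bool" where
  "cell S t T \<longleftrightarrow> (S, t, T) \<in> ar Spans"

lemma span_iff:
  "span S \<longleftrightarrow> fst S \<in> ar C \<and> snd S \<in> ar C \<and> dm C (snd S) = apex C S \<and>
    cd C (fst S) = B \<and> cd C (snd S) = B"
  by (cases S) (auto simp: span_def span_cat_def apex_def)

lemma span_simps [simp]:
  assumes "span S"
  shows "fst S \<in> ar C" "snd S \<in> ar C" "dm C (fst S) = apex C S" "dm C (snd S) = apex C S"
    "cd C (fst S) = B" "cd C (snd S) = B" "apex C S \<in> ob C"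
proof -
  show *: "fst S \<in> ar C" "snd S \<in> ar C" "dm C (fst S) = apex C S" "dm C (snd S) = apex C S"
    "cd C (fst S) = B" "cd C (snd S) = B"
    using assms by (auto simp: span_iff apex_def)
  show "apex C S \<in> ob C" using dm_cd_ob(1)[OF *(1)] *(3) by simp
qed

lemma cell_iff:
  "cell S t T \<longleftrightarrow> span S \<and> span T \<and> t \<in> ar C \<and> dm C t = apex C S \<and> cd C t = apex C T \<and>
    fst T \<cdot> t = fst S \<and> snd T \<cdot> t = snd S"
  by (auto simp: cell_def span_def span_cat_def homs_def)

lemma cell_ar: "cell S t T \<Longrightarrow> t \<in> ar C" "cell S t T \<Longrightarrow> dm C t = apex C S" "cell S t T \<Longrightarrow> cd C t = apex C T"
  by (simp_all add: cell_iff)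

lemma cell_element:
  assumes "cell S t T" "h \<in> ar C" "cd C h = apex C S"
  shows "fst T \<cdot> (t \<cdot> h) = fst S \<cdot> h" "snd T \<cdot> (t \<cdot> h) = snd S \<cdot> h"
  using assms assoc_ar[of h t "fst T"] assoc_ar[of h t "snd T"] by (auto simp: cell_iff)

lemma Spans_simps [simp]:
  "dm Spans (S, t, T) = S" "cd Spans (S, t, T) = T"
  "idn Spans S = (S, idn C (apex C S), S)"
  "(T, t', U) \<cdot>\<^bsub>Spans\<^esub> (S, t, T') = (S, t' \<cdot> t, U)"
  by (simp_all add: span_cat_def)

lemma mem_homs_Spans [simp]: "(S', t, T') \<in> homs Spans S T \<longleftrightarrow> S' = S \<and> T' = T \<and> cell S t T"
  by (auto simp: homs_def cell_def)

lemma mem_homs_SpansE: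
  assumes "x \<in> homs Spans S T"
  obtains t where "x = (S, t, T)" "cell S t T"
  using assms by (cases x) auto

lemma cell_idn: "span S \<Longrightarrow> cell S (idn C (apex C S)) S"
  by (simp add: cell_iff)

lemma cell_cmp: "cell S t T \<Longrightarrow> cell T t' U \<Longrightarrow> cell S (t' \<cdot> t) U"
  using cell_element[of T t' U t] by (auto simp: cell_iff)

text \<open>The generalized elements of \<open>Y \<otimes> X\<close>, as pairs: \<open>u\<close> and \<open>v\<close> have a common domain and agree
  over the middle object. For the span of an internal category these are its composable pairs.\<close>

definition composable :: "'m span \<Rightarrow> 'm span \<Rightarrow> 'm \<Rightarrow> 'm \<Rightarrow> bool" where
  "composable Y X u v \<longleftrightarrow> u \<in> ar C \<and> v \<in> ar C \<and> dm C u = dm C v \<and>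
    cd C u = apex C Y \<and> cd C v = apex C X \<and> fst Y \<cdot> u = snd X \<cdot> v"

lemma pullback:
  assumes "span Y" "span X"
  shows "is_pullback C (fst Y) (snd X) (tens_pr1 C Y X) (tens_pr2 C Y X)"
  using pullbacks assms unfolding chosen_pullbacks_def tens_pr1_def tens_pr2_def by simp

context
  fixes Y X assumes YX [simp]: "span Y" "span X"
begin

lemma tens_pr [simp]:
  shows "tens_pr1 C Y X \<in> ar C" "dm C (tens_pr1 C Y X) = apex C (tens_ob C Y X)"
    "cd C (tens_pr1 C Y X) = apex C Y"
    "tens_pr2 C Y X \<in> ar C" "dm C (tens_pr2 C Y X) = apex C (tens_ob C Y X)"
    "cd C (tens_pr2 C Y X) = apex C X"
proof -
  have *: "tens_pr1 C Y X \<in> ar C \<and> tens_pr2 C Y X \<in> ar C \<and>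
      dm C (tens_pr1 C Y X) = dm C (tens_pr2 C Y X) \<and>
      cd C (tens_pr1 C Y X) = dm C (fst Y) \<and> cd C (tens_pr2 C Y X) = dm C (snd X)"
    using pullback[OF YX] unfolding is_pullback_def by blast
  then show "tens_pr1 C Y X \<in> ar C" "tens_pr2 C Y X \<in> ar C"
    "cd C (tens_pr1 C Y X) = apex C Y" "cd C (tens_pr2 C Y X) = apex C X"
    by simp_all
  show "dm C (tens_pr2 C Y X) = apex C (tens_ob C Y X)"
    using * by (simp add: tens_ob_def apex_def[of C "(_, _)"])
  then show "dm C (tens_pr1 C Y X) = apex C (tens_ob C Y X)" using * by simp
qed

lemma composable_tens_pr: "composable Y X (tens_pr1 C Y X) (tens_pr2 C Y X)"
proof -
  have "fst Y \<cdot> tens_pr1 C Y X = snd X \<cdot> tens_pr2 C Y X"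
    using pullback[OF YX] unfolding is_pullback_def by blast
  then show ?thesis by (simp add: composable_def)
qed

lemma tens_ob_legs [simp]:
  "fst (tens_ob C Y X) = fst X \<cdot> tens_pr2 C Y X" "snd (tens_ob C Y X) = snd Y \<cdot> tens_pr1 C Y X"
  by (simp_all add: tens_ob_def)

lemma span_tens_ob [simp]: "span (tens_ob C Y X)"
  unfolding span_iff by simp

lemma tens_pair:
  assumes "composable Y X u v"
  shows "tens_pair C Y X u v \<in> ar C" "dm C (tens_pair C Y X u v) = dm C u"
    "cd C (tens_pair C Y X u v) = apex C (tens_ob C Y X)"
    "tens_pr1 C Y X \<cdot> tens_pair C Y X u v = u" "tens_pr2 C Y X \<cdot> tens_pair C Y X u v = v"
proof -
  let ?p = "tens_pr1 C Y X" and ?q = "tens_pr2 C Y X"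
  have "u \<in> homs C (dm C u) (dm C (fst Y))" "v \<in> homs C (dm C u) (dm C (snd X))"
    "fst Y \<cdot> u = snd X \<cdot> v"
    using assms by (auto simp: composable_def homs_def)
  then have "\<exists>!h. h \<in> homs C (dm C u) (dm C ?p) \<and> ?p \<cdot> h = u \<and> ?q \<cdot> h = v"
    using pullback[OF YX] unfolding is_pullback_def by blast
  from theI'[OF this]
  have "tens_pair C Y X u v \<in> homs C (dm C u) (dm C ?p)
      \<and> ?p \<cdot> tens_pair C Y X u v = u \<and> ?q \<cdot> tens_pair C Y X u v = v"
    unfolding tens_pair_def pairing_def tens_pr1_def tens_pr2_def .
  then show "tens_pair C Y X u v \<in> ar C" "dm C (tens_pair C Y X u v) = dm C u"
    "cd C (tens_pair C Y X u v) = apex C (tens_ob C Y X)"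
    "?p \<cdot> tens_pair C Y X u v = u" "?q \<cdot> tens_pair C Y X u v = v"
    by (auto simp: homs_def)
qed

lemma composable_cmp:
  assumes "composable Y X u v" "h \<in> ar C" "cd C h = dm C u"
  shows "composable Y X (u \<cdot> h) (v \<cdot> h)"
proof -
  have "fst Y \<cdot> (u \<cdot> h) = (fst Y \<cdot> u) \<cdot> h" "(snd X \<cdot> v) \<cdot> h = snd X \<cdot> (v \<cdot> h)"
    using assms by (simp_all del: assoc_ar add: assoc_ar[symmetric] composable_def)
  then show ?thesis using assms by (simp add: composable_def)
qed

lemma composable_pr_cmp:
  assumes "h \<in> ar C" "cd C h = apex C (tens_ob C Y X)"
  shows "composable Y X (tens_pr1 C Y X \<cdot> h) (tens_pr2 C Y X \<cdot> h)"
  using assms by (intro composable_cmp composable_tens_pr) simp_all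

text \<open>The uniqueness half of the pullback property, in the form in which it rewrites an arbitrary
  element of \<open>Y \<otimes> X\<close> as a pair.\<close>

lemma tens_pair_eqI:
  assumes "h \<in> ar C" "cd C h = apex C (tens_ob C Y X)"
    "tens_pr1 C Y X \<cdot> h = u" "tens_pr2 C Y X \<cdot> h = v"
  shows "h = tens_pair C Y X u v"
proof -
  let ?p = "tens_pr1 C Y X" and ?q = "tens_pr2 C Y X"
  have uv: "composable Y X u v" using composable_pr_cmp[OF assms(1,2)] assms(3,4) by simp
  have u: "dm C u = dm C h" using assms by auto
  have "u \<in> homs C (dm C h) (dm C (fst Y))" "v \<in> homs C (dm C h) (dm C (snd X))"
    "fst Y \<cdot> u = snd X \<cdot> v"
    using uv u by (auto simp: composable_def homs_def)
  then have "\<exists>!k. k \<in> homs C (dm C h) (dm C ?p) \<and> ?p \<cdot> k = u \<and> ?q \<cdot> k = v"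
    using pullback[OF YX] unfolding is_pullback_def by blast
  moreover have "h \<in> homs C (dm C h) (dm C ?p)" using assms by (simp add: homs_def)
  moreover have "tens_pair C Y X u v \<in> homs C (dm C h) (dm C ?p)"
    using tens_pair[OF uv] u by (simp add: homs_def)
  ultimately show ?thesis using tens_pair(4,5)[OF uv] assms(3,4) by blast
qed

lemma tens_pair_cmp:
  assumes "composable Y X u v" "h \<in> ar C" "cd C h = dm C u"
  shows "tens_pair C Y X u v \<cdot> h = tens_pair C Y X (u \<cdot> h) (v \<cdot> h)"
proof (rule tens_pair_eqI)
  note p = tens_pair[OF assms(1)]
  show "tens_pr1 C Y X \<cdot> (tens_pair C Y X u v \<cdot> h) = u \<cdot> h"
    using p assms assoc_ar[of h "tens_pair C Y X u v" "tens_pr1 C Y X"] by simp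
  show "tens_pr2 C Y X \<cdot> (tens_pair C Y X u v \<cdot> h) = v \<cdot> h"
    using p assms assoc_ar[of h "tens_pair C Y X u v" "tens_pr2 C Y X"] by simp
qed (use tens_pair[OF assms(1)] assms in simp_all)

lemma tens_pair_legs:
  assumes "composable Y X u v"
  shows "fst (tens_ob C Y X) \<cdot> tens_pair C Y X u v = fst X \<cdot> v"
    "snd (tens_ob C Y X) \<cdot> tens_pair C Y X u v = snd Y \<cdot> u"
  using tens_pair[OF assms] by simp_all

end

lemma composable_cells:
  assumes "cell Y s Y'" "cell X t X'" "composable Y X u v"
  shows "composable Y' X' (s \<cdot> u) (t \<cdot> v)"
  using assms cell_element[OF assms(1), of u] cell_element[OF assms(2), of v]
  by (auto simp: composable_def cell_iff)

definition tens_ar :: "'m span \<Rightarrow> 'm \<Rightarrow> 'm span \<Rightarrow> 'm span \<Rightarrow> 'm \<Rightarrow> 'm span \<Rightarrow> 'm" where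
  "tens_ar Y s Y' X t X' = tens_pair C Y' X' (s \<cdot> tens_pr1 C Y X) (t \<cdot> tens_pr2 C Y X)"

lemma tens_eq: "tens C (Y, s, Y') (X, t, X') = (tens_ob C Y X, tens_ar Y s Y' X t X', tens_ob C Y' X')"
  by (simp add: tens_def tens_ar_def)

text \<open>On elements, the tensor product of 2-cells acts componentwise.\<close>

lemma tens_element:
  assumes "cell Y s Y'" "cell X t X'" "composable Y X u v"
  shows "tens_ar Y s Y' X t X' \<cdot> tens_pair C Y X u v = tens_pair C Y' X' (s \<cdot> u) (t \<cdot> v)"
proof -
  have [simp]: "span Y" "span X" "span Y'" "span X'" using assms by (auto simp: cell_iff)
  note p = tens_pair[OF _ _ assms(3)]
  have c: "composable Y' X' (s \<cdot> tens_pr1 C Y X) (t \<cdot> tens_pr2 C Y X)"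
    using assms by (intro composable_cells[OF _ _ composable_tens_pr]) auto
  show ?thesis
    unfolding tens_ar_def using assms p by (subst tens_pair_cmp[OF _ _ c]) (auto simp: cell_iff)
qed

lemma cell_tens_ar:
  assumes "cell Y s Y'" "cell X t X'"
  shows "cell (tens_ob C Y X) (tens_ar Y s Y' X t X') (tens_ob C Y' X')"
proof -
  have [simp]: "span Y" "span X" "span Y'" "span X'" using assms by (auto simp: cell_iff)
  have c: "composable Y' X' (s \<cdot> tens_pr1 C Y X) (t \<cdot> tens_pr2 C Y X)"
    using assms by (intro composable_cells[OF _ _ composable_tens_pr]) auto
  show ?thesis
    using assms tens_pair[OF _ _ c] tens_pair_legs[OF _ _ c]
      cell_element(2)[OF assms(1), of "tens_pr1 C Y X"] cell_element(1)[OF assms(2), of "tens_pr2 C Y X"]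
    unfolding cell_iff tens_ar_def by auto
qed

definition tens_assoc_ar :: "'m span \<Rightarrow> 'm span \<Rightarrow> 'm span \<Rightarrow> 'm" where
  "tens_assoc_ar Z Y X = arrow (assoc_cell C Z Y X)"

lemma assoc_cell_eq:
  "assoc_cell C Z Y X =
    (tens_ob C (tens_ob C Z Y) X, tens_assoc_ar Z Y X, tens_ob C Z (tens_ob C Y X))"
  by (simp add: tens_assoc_ar_def assoc_cell_def arrow_def Let_def)

lemma composable_tens_left:
  assumes "span Z" "span Y" "span X" "composable Z Y z y" "composable Y X y x"
  shows "composable (tens_ob C Z Y) X (tens_pair C Z Y z y) x"
  using tens_pair[OF assms(1,2,4)] tens_pair_legs[OF assms(1,2,4)] assms
  by (auto simp: composable_def)

lemma composable_tens_right:
  assumes "span Z" "span Y" "span X" "composable Z Y z y" "composable Y X y x"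
  shows "composable Z (tens_ob C Y X) z (tens_pair C Y X y x)"
  using tens_pair[OF assms(2,3,5)] tens_pair_legs[OF assms(2,3,5)] assms
  by (auto simp: composable_def)

lemma tens_assoc_ar:
  assumes S: "span Z" "span Y" "span X"
  shows "tens_assoc_ar Z Y X \<in> ar C"
    "dm C (tens_assoc_ar Z Y X) = apex C (tens_ob C (tens_ob C Z Y) X)"
    "cd C (tens_assoc_ar Z Y X) = apex C (tens_ob C Z (tens_ob C Y X))"
proof -
  let ?q = "tens_pr1 C (tens_ob C Z Y) X" and ?r = "tens_pr2 C (tens_ob C Z Y) X"
  note [simp] = S
  have z: "composable Z Y (tens_pr1 C Z Y \<cdot> ?q) (tens_pr2 C Z Y \<cdot> ?q)"
    by (rule composable_pr_cmp) simp_all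
  have y: "composable Y X (tens_pr2 C Z Y \<cdot> ?q) ?r"
    using composable_tens_pr[of "tens_ob C Z Y" X] by (simp add: composable_def)
  from tens_pair[OF _ _ composable_tens_right[OF S z y]]
  show "tens_assoc_ar Z Y X \<in> ar C"
    "dm C (tens_assoc_ar Z Y X) = apex C (tens_ob C (tens_ob C Z Y) X)"
    "cd C (tens_assoc_ar Z Y X) = apex C (tens_ob C Z (tens_ob C Y X))"
    by (simp_all add: tens_assoc_ar_def assoc_cell_def arrow_def Let_def)
qed

text \<open>On elements, the associator is \<open>((z, y), x) \<mapsto> (z, (y, x))\<close>. With this the coherence cells
  disappear from every later computation.\<close>

lemma assoc_element:
  assumes S: "span Z" "span Y" "span X" and c: "composable Z Y z y" "composable Y X y x"
  shows "tens_assoc_ar Z Y X \<cdot> tens_pair C (tens_ob C Z Y) X (tens_pair C Z Y z y) x =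
    tens_pair C Z (tens_ob C Y X) z (tens_pair C Y X y x)"
proof -
  let ?h = "tens_pair C (tens_ob C Z Y) X (tens_pair C Z Y z y) x"
  let ?q = "tens_pr1 C (tens_ob C Z Y) X" and ?r = "tens_pr2 C (tens_ob C Z Y) X"
  note [simp] = S
  note h = tens_pair[OF _ _ composable_tens_left[OF S c], simplified]
  note zy = tens_pair[OF S(1,2) c(1)]
  have z: "composable Z Y (tens_pr1 C Z Y \<cdot> ?q) (tens_pr2 C Z Y \<cdot> ?q)"
    by (rule composable_pr_cmp) simp_all
  have y: "composable Y X (tens_pr2 C Z Y \<cdot> ?q) ?r"
    using composable_tens_pr[of "tens_ob C Z Y" X] by (simp add: composable_def)
  note zyx = composable_tens_right[OF S z y]
  have "dm C z = dm C y" "dm C ?h = dm C z" using c h zy by (auto simp: composable_def)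
  then show ?thesis
    using h zy z
    by (simp add: tens_assoc_ar_def assoc_cell_def arrow_def Let_def
        tens_pair_cmp[OF _ _ zyx] tens_pair_cmp[OF _ _ y])
qed

lemma category_Spans: "category Spans"
  unfolding span_cat_def
proof (rule category_tagged_cat, goal_cases)
  case (1 S)
  then show ?case using cell_idn[of S] by (auto simp: cell_def span_def span_cat_def)
next
  case (2 S T U t t')
  then show ?case using cell_cmp[of S t T t' U] by (auto simp: cell_def span_cat_def)
next
  case (3 S T t)
  then show ?case by (auto simp: homs_def)
next
  case (4 S T t)
  then show ?case by (auto simp: homs_def)
next
  case (5 S T U V t t' t'')
  then show ?case by (auto simp: homs_def)
qed

lemma tens_ar_cmp:
  assumes "cell Y s Y'" "cell Y' s' Y''" "cell X t X'" "cell X' t' X''"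
  shows "tens_ar Y' s' Y'' X' t' X'' \<cdot> tens_ar Y s Y' X t X' = tens_ar Y (s' \<cdot> s) Y'' X (t' \<cdot> t) X''"
proof -
  have [simp]: "span Y" "span X" using assms by (auto simp: cell_iff)
  have "composable Y' X' (s \<cdot> tens_pr1 C Y X) (t \<cdot> tens_pr2 C Y X)"
    using assms by (intro composable_cells[OF _ _ composable_tens_pr]) auto
  from tens_element[OF assms(2,4) this] show ?thesis
    using assms by (simp add: tens_ar_def[of Y] cell_iff)
qed

lemma tens_ar_idn:
  assumes "span Y" "span X"
  shows "tens_ar Y (idn C (apex C Y)) Y X (idn C (apex C X)) X = idn C (apex C (tens_ob C Y X))"
  unfolding tens_ar_def
  by (rule tens_pair_eqI[symmetric]) (use assms in simp_all)

lemma diag_span_simps [simp]: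
  "fst (diag_span f) = f" "snd (diag_span f) = f" "apex C (diag_span f) = dm C f"
  "diag_span f = diag_span g \<longleftrightarrow> f = g" "to_slice_ob (diag_span f) = f"
  by (auto simp: diag_span_def apex_def to_slice_ob_def)

lemma span_diag: "span (diag_span f) \<longleftrightarrow> f \<in> ar C \<and> cd C f = B"
  by (auto simp: span_iff)

lemma mem_ob_slice: "f \<in> ob (slice C B) \<longleftrightarrow> span (diag_span f)"
  by (auto simp: slice_def span_diag)

lemma mem_ar_slice: "(f, t, g) \<in> ar (slice C B) \<longleftrightarrow> cell (diag_span f) t (diag_span g)"
  by (auto simp: slice_def cell_iff span_diag homs_def)

lemma category_slice: "category (slice C B)"
  unfolding slice_def
proof (rule category_tagged_cat, goal_cases)
  case (2 f g h t t')
  then show ?case using cell_cmp[of "diag_span f" t "diag_span g" t' "diag_span h"]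
    by (auto simp: cell_iff span_diag homs_def)
qed (auto simp: homs_def)

lemma slice_simps [simp]:
  "dm (slice C B) (f, t, g) = f" "cd (slice C B) (f, t, g) = g"
  "idn (slice C B) f = (f, idn C (dm C f), f)"
  "(g', t', h) \<cdot>\<^bsub>slice C B\<^esub> (f, t, g) = (f, t' \<cdot> t, h)"
  by (simp_all add: slice_def)

end


section \<open>Generalized elements of the monoid\<close>

locale monoid_in_spans = spans_over C "obj0 M" + internal_category C M
  for C :: "('o, 'm) pb_cat" (structure) and M :: "('o, 'm) internal_cat"
begin

abbreviation MM :: "'m span" where "MM \<equiv> mspan M"

abbreviation unit :: "'m span" where "unit \<equiv> unit_span C (obj0 M)"

abbreviation Slice :: "('m, 'm \<times> 'm \<times> 'm) cat" where "Slice \<equiv> slice C (obj0 M)"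

lemma span_MM [simp]: "span MM"
  using src tgt by (auto simp: span_iff mspan_def homs_def apex_def)

lemma apex_unit [simp]: "apex C unit = obj0 M"
  using B by (simp add: unit_span_def apex_def)

lemma unit_legs [simp]: "fst unit = idn C (obj0 M)" "snd unit = idn C (obj0 M)"
  by (simp_all add: unit_span_def)

lemma span_unit [simp]: "span unit"
  unfolding span_iff using B by simp

lemma cell_eta: "cell unit (idt M) MM"
  using eta by (simp add: eta_cell_def cell_def)

lemma cell_mu: "cell (tens_ob C MM MM) (mul M) MM"
  using mu by (simp add: mu_cell_def cell_def)

lemma cell_id_MM: "cell MM (idn C (apex C MM)) MM"
  by (rule cell_idn) simp

text \<open>Composition of generalized arrows of the internal category, \<open>m\<close> after \<open>n\<close>.\<close>

definition mult :: "'m \<Rightarrow> 'm \<Rightarrow> 'm" (infixl "\<odot>" 70) where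
  "m \<odot> n = mul M \<cdot> tens_pair C MM MM m n"

lemma mult:
  assumes "composable MM MM m n"
  shows "m \<odot> n \<in> ar C" "dm C (m \<odot> n) = dm C m" "cd C (m \<odot> n) = apex C MM"
    "fst MM \<cdot> (m \<odot> n) = fst MM \<cdot> n" "snd MM \<cdot> (m \<odot> n) = snd MM \<cdot> m"
proof -
  note p = tens_pair[OF span_MM span_MM assms] and mu = cell_ar[OF cell_mu]
  show "m \<odot> n \<in> ar C" "dm C (m \<odot> n) = dm C m" "cd C (m \<odot> n) = apex C MM"
    using p(1-3) mu by (simp_all add: mult_def)
  show "fst MM \<cdot> (m \<odot> n) = fst MM \<cdot> n" "snd MM \<cdot> (m \<odot> n) = snd MM \<cdot> m"
    unfolding mult_def
    using cell_element[OF cell_mu p(1,3)] tens_pair_legs[OF span_MM span_MM assms]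
    by (simp_all del: tens_ob_legs)
qed

lemma mult_cmp:
  assumes "composable MM MM m n" "h \<in> ar C" "cd C h = dm C m"
  shows "(m \<odot> n) \<cdot> h = (m \<cdot> h) \<odot> (n \<cdot> h)"
  using tens_pair[OF _ _ assms(1)] cell_mu assms tens_pair_cmp[OF _ _ assms]
  by (simp add: mult_def cell_iff)

text \<open>The monoid axiom is an equation of 2-cells out of \<open>(M \<otimes> M) \<otimes> M\<close>. Evaluating it at the
  element \<open>((m, n), p)\<close> gives associativity for composable generalized arrows.\<close>

lemma mult_assoc:
  assumes mn: "composable MM MM m n" and np: "composable MM MM n p"
  shows "(m \<odot> n) \<odot> p = m \<odot> (n \<odot> p)"
proof -
  let ?T = "tens_ob C MM MM" and ?i = "idn C (apex C MM)"
  let ?h = "tens_pair C ?T MM (tens_pair C MM MM m n) p"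
  let ?l = "tens_ar ?T (mul M) MM MM ?i MM" and ?r = "tens_ar MM ?i MM ?T (mul M) MM"
  let ?a = "tens_assoc_ar MM MM MM"
  have left: "composable ?T MM (tens_pair C MM MM m n) p"
    and right: "composable MM ?T m (tens_pair C MM MM n p)"
    using mn np by (auto intro: composable_tens_left composable_tens_right)
  note h = tens_pair[OF _ _ left, simplified]
  have ass: "mul M \<cdot> ?l = (mul M \<cdot> ?r) \<cdot> ?a"
    using mu_assoc by (simp add: mu_cell_def id_mspan_def tens_eq assoc_cell_eq)
  have "cell (tens_ob C ?T MM) ?l ?T" "cell (tens_ob C MM ?T) ?r ?T"
    by (intro cell_tens_ar cell_mu cell_id_MM)+
  note ar = this[THEN cell_ar(1)] this[THEN cell_ar(2)] this[THEN cell_ar(3)]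
    cell_ar[OF cell_mu] tens_assoc_ar[OF span_MM span_MM span_MM] h(1,3)
  have "(m \<odot> n) \<odot> p = mul M \<cdot> (?l \<cdot> ?h)"
    using tens_element[OF cell_mu cell_id_MM left] mn np by (simp add: mult_def composable_def)
  also have "\<dots> = (mul M \<cdot> ?l) \<cdot> ?h"
    by (rule assoc_ar[symmetric]) (simp_all add: ar)
  also have "\<dots> = mul M \<cdot> (?r \<cdot> (?a \<cdot> ?h))"
    unfolding ass by (simp add: ar)
  also have "?a \<cdot> ?h = tens_pair C MM ?T m (tens_pair C MM MM n p)"
    using mn np by (intro assoc_element) auto
  also have "mul M \<cdot> (?r \<cdot> tens_pair C MM ?T m (tens_pair C MM MM n p)) = m \<odot> (n \<odot> p)"
    using tens_element[OF cell_id_MM cell_mu right] mn np by (simp add: mult_def composable_def)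
  finally show ?thesis .
qed

text \<open>By \<open>loop_iff\<close> below, \<open>p\<close> is a generalized arrow of the internal category from \<open>f\<close> to
  \<open>f\<close>, which is why any two loops at \<open>f\<close> are composable.\<close>

definition loop :: "'m \<Rightarrow> 'm \<Rightarrow> bool" where
  "loop f p \<longleftrightarrow> cell (diag_span f) p MM"

lemma loop_iff:
  "loop f p \<longleftrightarrow> f \<in> ar C \<and> cd C f = obj0 M \<and> p \<in> ar C \<and> dm C p = dm C f \<and>
    cd C p = apex C MM \<and> fst MM \<cdot> p = f \<and> snd MM \<cdot> p = f"
  by (auto simp: loop_def cell_iff span_diag)

lemma composable_loops: "loop f p \<Longrightarrow> loop f q \<Longrightarrow> composable MM MM p q"
  by (simp add: loop_iff composable_def)

lemma loop_mult: "loop f p \<Longrightarrow> loop f q \<Longrightarrow> loop f (p \<odot> q)"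
  using mult[OF composable_loops[of f p q]] by (simp add: loop_iff)

lemma loop_one: "span (diag_span f) \<Longrightarrow> loop f (idt M \<cdot> f)"
  unfolding loop_def by (rule cell_cmp[OF _ cell_eta]) (simp add: cell_iff span_diag)

lemma loop_cmp: "loop g q \<Longrightarrow> cell (diag_span f) t (diag_span g) \<Longrightarrow> loop f (q \<cdot> t)"
  unfolding loop_def by (rule cell_cmp)

text \<open>The unit axiom evaluated at the element \<open>p\<close>: the unit isomorphism sends \<open>p\<close> to the pair of
  its codomain \<open>f\<close> and \<open>p\<close> itself, and \<open>\<eta>\<close> turns \<open>f\<close> into the identity arrow at \<open>f\<close>.\<close>

lemma mult_one_left:
  assumes "loop f p"
  shows "(idt M \<cdot> f) \<odot> p = p"
proof -
  let ?i = "idn C (apex C MM)" and ?e = "tens_pair C unit MM (snd MM) (idn C (apex C MM))"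
  let ?l = "tens_ar unit (idt M) MM MM ?i MM"
  note p = assms[unfolded loop_iff]
  have c: "composable unit MM (snd MM) ?i" using B by (simp add: composable_def)
  have e: "cell (tens_ob C unit MM) ?l (tens_ob C MM MM)"
    by (intro cell_tens_ar cell_eta cell_id_MM)
  have i: "idt M \<in> ar C" "dm C (idt M) = obj0 M" using cell_eta by (simp_all add: cell_iff)
  have "(mul M \<cdot> ?l) \<cdot> ?e = ?i"
    using mu_lunit by (simp add: mu_cell_def id_mspan_def eta_cell_def tens_eq lunit_cell_def)
  moreover have "(mul M \<cdot> ?l) \<cdot> ?e = mul M \<cdot> (?l \<cdot> ?e)"
    using cell_mu e tens_pair[OF _ _ c] by (simp add: cell_iff)
  moreover have "?l \<cdot> ?e = tens_pair C MM MM (idt M \<cdot> snd MM) ?i"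
    using tens_element[OF cell_eta cell_id_MM c] by simp
  ultimately have "((idt M \<cdot> snd MM) \<odot> ?i) \<cdot> p = p"
    using p by (simp add: mult_def)
  moreover have "composable MM MM (idt M \<cdot> snd MM) ?i"
    using composable_cells[OF cell_eta cell_id_MM c] by simp
  from mult_cmp[OF this, of p] have "((idt M \<cdot> snd MM) \<odot> ?i) \<cdot> p = (idt M \<cdot> f) \<odot> p"
    using p i by simp
  ultimately show ?thesis by simp
qed

lemma mult_one_right:
  assumes "loop f p"
  shows "p \<odot> (idt M \<cdot> f) = p"
proof -
  let ?i = "idn C (apex C MM)" and ?e = "tens_pair C MM unit (idn C (apex C MM)) (fst MM)"
  let ?r = "tens_ar MM ?i MM unit (idt M) MM"
  note p = assms[unfolded loop_iff]
  have c: "composable MM unit ?i (fst MM)" using B by (simp add: composable_def)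
  have e: "cell (tens_ob C MM unit) ?r (tens_ob C MM MM)"
    by (intro cell_tens_ar cell_eta cell_id_MM)
  have i: "idt M \<in> ar C" "dm C (idt M) = obj0 M" using cell_eta by (simp_all add: cell_iff)
  have "(mul M \<cdot> ?r) \<cdot> ?e = ?i"
    using mu_runit by (simp add: mu_cell_def id_mspan_def eta_cell_def tens_eq runit_cell_def)
  moreover have "(mul M \<cdot> ?r) \<cdot> ?e = mul M \<cdot> (?r \<cdot> ?e)"
    using cell_mu e tens_pair[OF _ _ c] by (simp add: cell_iff)
  moreover have "?r \<cdot> ?e = tens_pair C MM MM ?i (idt M \<cdot> fst MM)"
    using tens_element[OF cell_id_MM cell_eta c] by simp
  ultimately have "(?i \<odot> (idt M \<cdot> fst MM)) \<cdot> p = p"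
    using p by (simp add: mult_def)
  moreover have "composable MM MM ?i (idt M \<cdot> fst MM)"
    using composable_cells[OF cell_id_MM cell_eta c] by simp
  from mult_cmp[OF this, of p] have "(?i \<odot> (idt M \<cdot> fst MM)) \<cdot> p = p \<odot> (idt M \<cdot> f)"
    using p i by simp
  ultimately show ?thesis by simp
qed


section \<open>The fibration of loops\<close>

definition loop_cell :: "'m \<Rightarrow> 'm \<Rightarrow> 'm cell" where
  "loop_cell f p = (diag_span f, p, MM)"

definition base_cell :: "'m \<Rightarrow> 'm \<Rightarrow> 'm \<Rightarrow> 'm cell" where
  "base_cell f t g = (diag_span f, t, diag_span g)"

lemma loop_cell_inject [simp]: "loop_cell f p = loop_cell g q \<longleftrightarrow> f = g \<and> p = q"
  by (simp add: loop_cell_def)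

lemma homs_loop: "homs Spans (diag_span f) MM = {loop_cell f p | p. loop f p}"
  by (auto simp: loop_cell_def loop_def elim!: mem_homs_SpansE)

lemma ob_Conv: "ob (Conv C M) = {loop_cell f p | f p. loop f p}"
  by (auto simp: Conv_def homs_loop mem_ob_slice span_diag loop_iff)

lemma mem_ar_Conv:
  "x \<in> ar (Conv C M) \<longleftrightarrow> (\<exists>f p g q t. x = (loop_cell f p, base_cell f t g, loop_cell g q) \<and>
    loop f p \<and> loop g q \<and> cell (diag_span f) t (diag_span g) \<and> q \<cdot> t = p)"
proof -
  obtain \<alpha> \<phi> \<beta> where x: "x = (\<alpha>, \<phi>, \<beta>)" by (cases x)
  have "x \<in> ar (Conv C M) \<longleftrightarrow> \<alpha> \<in> ob (Conv C M) \<and> \<beta> \<in> ob (Conv C M) \<and>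
      \<phi> \<in> homs Spans (dm Spans \<alpha>) (dm Spans \<beta>) \<and> \<beta> \<cdot>\<^bsub>Spans\<^esub> \<phi> = \<alpha>"
    by (simp add: x Conv_def)
  then show ?thesis
    unfolding ob_Conv x
    by (auto simp: loop_cell_def base_cell_def elim!: mem_homs_SpansE)
qed

lemma Conv_simps [simp]:
  "dm (Conv C M) (\<alpha>, \<phi>, \<beta>) = \<alpha>" "cd (Conv C M) (\<alpha>, \<phi>, \<beta>) = \<beta>"
  "idn (Conv C M) (loop_cell f p) = (loop_cell f p, base_cell f (idn C (dm C f)) f, loop_cell f p)"
  "(\<beta>', base_cell g t' h, \<gamma>) \<cdot>\<^bsub>Conv C M\<^esub> (\<alpha>, base_cell f t g', \<beta>) = (\<alpha>, base_cell f (t' \<cdot> t) h, \<gamma>)"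
  by (simp_all add: Conv_def loop_cell_def base_cell_def)

lemma P_fun_simps [simp]:
  "fo (P_fun C M) (loop_cell f p) = f"
  "fm (P_fun C M) (\<alpha>, base_cell f t g, \<beta>) = (f, t, g)"
  by (simp_all add: P_fun_def loop_cell_def base_cell_def to_slice_ar_def)

lemma category_Conv: "category (Conv C M)"
proof -
  interpret S: category Spans by (rule category_Spans)
  show ?thesis
    unfolding Conv_def
  proof (rule category_tagged_cat, goal_cases)
    case (1 \<alpha>)
    then show ?case by (auto simp: homs_def simp del: Spans_simps)
  next
    case (2 \<alpha> \<beta> \<gamma> t t')
    then have *: "t \<in> ar Spans" "t' \<in> ar Spans" "\<gamma> \<in> ar Spans" "dm Spans t = dm Spans \<alpha>"
      "cd Spans t = dm Spans t'" "cd Spans t' = dm Spans \<gamma>"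
      "\<gamma> \<cdot>\<^bsub>Spans\<^esub> t' = \<beta>" "\<beta> \<cdot>\<^bsub>Spans\<^esub> t = \<alpha>"
      by (simp_all add: homs_def)
    then have "\<gamma> \<cdot>\<^bsub>Spans\<^esub> (t' \<cdot>\<^bsub>Spans\<^esub> t) = \<alpha>"
      using S.assoc_ar[of t t' \<gamma>] by simp
    with * show ?case by (simp add: homs_def)
  next
    case (3 \<alpha> \<beta> t)
    then show ?case by (simp add: homs_def del: Spans_simps)
  next
    case (4 \<alpha> \<beta> t)
    then show ?case by (simp add: homs_def del: Spans_simps)
  next
    case (5 \<alpha> \<beta> \<gamma> \<delta> t t' t'')
    then show ?case by (simp add: homs_def)
  qed
qed

lemma functor_P: "cat_functor (Conv C M) Slice (P_fun C M)"
proof (intro cat_functor.intro cat_functor_axioms.intro category_Conv category_slice)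
  fix \<alpha> assume "\<alpha> \<in> ob (Conv C M)"
  then obtain f p where [simp]: "\<alpha> = loop_cell f p" and "loop f p" by (auto simp: ob_Conv)
  then show "fo (P_fun C M) \<alpha> \<in> ob Slice"
    "fm (P_fun C M) (idn (Conv C M) \<alpha>) = idn Slice (fo (P_fun C M) \<alpha>)"
    by (auto simp: mem_ob_slice loop_def cell_iff)
next
  fix x \<alpha> \<beta> assume "x \<in> homs (Conv C M) \<alpha> \<beta>"
  then show "fm (P_fun C M) x \<in> homs Slice (fo (P_fun C M) \<alpha>) (fo (P_fun C M) \<beta>)"
    by (auto simp: homs_def mem_ar_Conv mem_ar_slice)
next
  fix x y \<alpha> \<beta> \<gamma> assume "x \<in> homs (Conv C M) \<alpha> \<beta>" "y \<in> homs (Conv C M) \<beta> \<gamma>"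
  then show "fm (P_fun C M) (y \<cdot>\<^bsub>Conv C M\<^esub> x) = fm (P_fun C M) y \<cdot>\<^bsub>Slice\<^esub> fm (P_fun C M) x"
    by (auto simp: homs_def mem_ar_Conv)
qed

lemma lift_arrow_Conv:
  assumes "loop g q" "cell (diag_span f) t (diag_span g)"
  shows "(loop_cell f (q \<cdot> t), base_cell f t g, loop_cell g q) \<in> ar (Conv C M)"
  using assms loop_cmp by (auto simp: mem_ar_Conv)

lemma discrete_fibration_P: "discrete_fibration (Conv C M) Slice (P_fun C M)"
proof (intro discrete_fibration.intro discrete_fibration_axioms.intro functor_P)
  fix \<beta> u assume \<beta>: "\<beta> \<in> ob (Conv C M)" and u: "u \<in> ar Slice" "cd Slice u = fo (P_fun C M) \<beta>"
  obtain g q where \<beta>_eq [simp]: "\<beta> = loop_cell g q" and q: "loop g q" using \<beta> by (auto simp: ob_Conv)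
  obtain f t where u_eq [simp]: "u = (f, t, g)" using u(2) by (cases u) auto
  have t: "cell (diag_span f) t (diag_span g)" using u(1) by (simp add: mem_ar_slice)
  show "\<exists>!x. x \<in> ar (Conv C M) \<and> cd (Conv C M) x = \<beta> \<and> fm (P_fun C M) x = u"
  proof (rule ex1I)
    show "(loop_cell f (q \<cdot> t), base_cell f t g, loop_cell g q) \<in> ar (Conv C M) \<and>
        cd (Conv C M) (loop_cell f (q \<cdot> t), base_cell f t g, loop_cell g q) = \<beta> \<and>
        fm (P_fun C M) (loop_cell f (q \<cdot> t), base_cell f t g, loop_cell g q) = u"
      using lift_arrow_Conv[OF q t] by simp
  qed (auto simp: mem_ar_Conv)
qed

sublocale P: discrete_fibration "Conv C M" Slice "P_fun C M"
  by (rule discrete_fibration_P)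

lemma P_reindex:
  assumes "loop g q" "cell (diag_span f) t (diag_span g)"
  shows "P.reindex (f, t, g) (loop_cell g q) = loop_cell f (q \<cdot> t)"
  using P.reindex_eqI[OF lift_arrow_Conv[OF assms]] by simp

lemma fibre_P: "fibre (Conv C M) (P_fun C M) f = {loop_cell f p | p. loop f p}"
  by (auto simp: fibre_def ob_Conv)

text \<open>The diagonal at the identity element is the pair \<open>(id, id)\<close>, which \<open>tens_element\<close> sends to
  \<open>(p, q)\<close>; so convolution is pointwise composition of loops.\<close>

lemma conv_monoid_simps:
  assumes "span (diag_span f)"
  shows "carrier (conv_monoid C M f) = {loop_cell f p | p. loop f p}"
    "loop f p \<Longrightarrow> loop f q \<Longrightarrow> loop_cell f p \<otimes>\<^bsub>conv_monoid C M f\<^esub> loop_cell f q = loop_cell f (p \<odot> q)"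
    "\<one>\<^bsub>conv_monoid C M f\<^esub> = loop_cell f (idt M \<cdot> f)"
proof -
  let ?D = "diag_span f" and ?i = "idn C (dm C f)"
  show "carrier (conv_monoid C M f) = {loop_cell f p | p. loop f p}"
    by (simp add: conv_monoid_def homs_loop)
  show "\<one>\<^bsub>conv_monoid C M f\<^esub> = loop_cell f (idt M \<cdot> f)"
    by (simp add: conv_monoid_def eta_cell_def loop_cell_def)
  assume p: "loop f p" and q: "loop f q"
  have c: "composable ?D ?D ?i ?i" using assms by (simp add: composable_def span_diag)
  have cells: "cell ?D p MM" "cell ?D q MM" using p q by (simp_all add: loop_def)
  note ar = cell_ar[OF cell_mu] cell_ar[OF cell_tens_ar[OF cells]] tens_pair(1,3)[OF assms assms c]
  have "(mul M \<cdot> tens_ar ?D p MM ?D q MM) \<cdot> tens_pair C ?D ?D ?i ?i = p \<odot> q"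
    using tens_element[OF cells c] p q by (simp add: ar mult_def loop_iff)
  then show "loop_cell f p \<otimes>\<^bsub>conv_monoid C M f\<^esub> loop_cell f q = loop_cell f (p \<odot> q)"
    by (simp add: conv_monoid_def loop_cell_def tens_eq mu_cell_def diagonal_def)
qed

lemma monoid_conv:
  assumes "span (diag_span f)"
  shows "monoid (conv_monoid C M f)"
proof (rule monoidI)
  note [simp] = conv_monoid_simps[OF assms] loop_mult loop_one[OF assms] mult_one_left mult_one_right
  fix x y z
  assume "x \<in> carrier (conv_monoid C M f)" "y \<in> carrier (conv_monoid C M f)"
    "z \<in> carrier (conv_monoid C M f)"
  then show "(x \<otimes>\<^bsub>conv_monoid C M f\<^esub> y) \<otimes>\<^bsub>conv_monoid C M f\<^esub> z =
      x \<otimes>\<^bsub>conv_monoid C M f\<^esub> (y \<otimes>\<^bsub>conv_monoid C M f\<^esub> z)"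
    using mult_assoc composable_loops by auto
qed (use assms in \<open>auto simp: conv_monoid_simps loop_mult loop_one mult_one_left mult_one_right\<close>)

lemma one_cmp:
  assumes "cell (diag_span f) t (diag_span g)"
  shows "(idt M \<cdot> g) \<cdot> t = idt M \<cdot> f"
  using assms cell_ar[OF cell_eta] by (auto simp: cell_iff span_diag)

lemma mult_loops_cmp:
  assumes "loop g p" "loop g q" "cell (diag_span f) t (diag_span g)"
  shows "(p \<odot> q) \<cdot> t = (p \<cdot> t) \<odot> (q \<cdot> t)"
  using mult_cmp[OF composable_loops[OF assms(1,2)], of t] assms by (simp add: loop_iff cell_iff)

lemma factors_over_Mon_P:
  "factors_over_Mon (op_cat Slice) (base_change (Conv C M) Slice (P_fun C M)) (conv_monoid C M)"
proof (rule P.factors_over_MonI)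
  fix f assume "f \<in> ob Slice"
  then show "carrier (conv_monoid C M f) = fibre (Conv C M) (P_fun C M) f" "monoid (conv_monoid C M f)"
    by (simp_all add: mem_ob_slice conv_monoid_simps fibre_P monoid_conv)
next
  fix u assume "u \<in> ar Slice"
  then obtain f t g where u: "u = (f, t, g)" and t: "cell (diag_span f) t (diag_span g)"
    by (cases u) (simp add: mem_ar_slice)
  then have fg: "span (diag_span f)" "span (diag_span g)" by (auto simp: cell_iff)
  note [simp] = conv_monoid_simps[OF fg(1)] conv_monoid_simps[OF fg(2)] P_reindex[OF _ t]
    loop_mult loop_one[OF fg(2)] loop_cmp[OF _ t] mult_loops_cmp[OF _ _ t] one_cmp[OF t]
  show "P.reindex u \<in> hom (conv_monoid C M (cd Slice u)) (conv_monoid C M (dm Slice u))"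
    unfolding u by (auto simp: hom_def)
  show "P.reindex u \<one>\<^bsub>conv_monoid C M (cd Slice u)\<^esub> = \<one>\<^bsub>conv_monoid C M (dm Slice u)\<^esub>"
    unfolding u by simp
qed


section \<open>The fibration of simply presented endomorphisms\<close>

text \<open>The element \<open>\<langle>id, p\<rangle>\<close> of the tensor product of the span of \<open>f\<close> with the span of \<open>M\<close>.\<close>

definition graph :: "'m \<Rightarrow> 'm \<Rightarrow> 'm" where
  "graph f p = tens_pair C (diag_span f) MM (idn C (dm C f)) p"

definition graph_cell :: "'m \<Rightarrow> 'm \<Rightarrow> 'm cell" where
  "graph_cell f p = (diag_span f, graph f p, fM C M f)"

lemma composable_graph:
  assumes "loop f p"
  shows "composable (diag_span f) MM (idn C (dm C f)) p"
  using assms by (simp add: loop_iff composable_def)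

lemma graph:
  assumes "loop f p"
  shows "cell (diag_span f) (graph f p) (fM C M f)"
    "tens_pr1 C (diag_span f) MM \<cdot> graph f p = idn C (dm C f)"
    "tens_pr2 C (diag_span f) MM \<cdot> graph f p = p"
proof -
  note c = composable_graph[OF assms]
  have D: "span (diag_span f)" using assms by (simp add: loop_def cell_iff)
  show "cell (diag_span f) (graph f p) (fM C M f)"
    using tens_pair[OF D span_MM c] tens_pair_legs[OF D span_MM c] D assms
    by (simp add: cell_iff graph_def fM_def loop_iff)
  show "tens_pr1 C (diag_span f) MM \<cdot> graph f p = idn C (dm C f)"
    "tens_pr2 C (diag_span f) MM \<cdot> graph f p = p"
    using tens_pair[OF D span_MM c] by (simp_all add: graph_def)
qed

lemma graph_cell_inject:
  assumes "loop f p" "loop g q"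
  shows "graph_cell f p = graph_cell g q \<longleftrightarrow> f = g \<and> p = q"
proof
  assume "graph_cell f p = graph_cell g q"
  then have fg: "f = g" and "graph f p = graph g q" unfolding graph_cell_def by auto
  with graph(3)[OF assms(1)] graph(3)[OF assms(2)] show "f = g \<and> p = q" by metis
qed simp

lemma tilde_loop_cell: "tilde C M (loop_cell f p) = graph_cell f p"
  by (simp add: tilde_def loop_cell_def graph_cell_def pair_cell_def graph_def arrow_def)

lemma bar_graph_cell: "loop f p \<Longrightarrow> bar C M (graph_cell f p) = loop_cell f p"
  using graph(3) by (simp add: bar_def loop_cell_def graph_cell_def piM_def)

lemma cell_piM:
  assumes "span (diag_span f)"
  shows "cell (fM C M f) (tens_pr2 C (diag_span f) MM) MM"
  using composable_tens_pr[OF assms span_MM] assms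
  by (simp add: cell_iff fM_def composable_def)

text \<open>The second projection of any 2-cell into \<open>fM C M f\<close> is a loop; being simply presented says
  that the 2-cell is the graph of that loop.\<close>

lemma simply_presented_iff:
  assumes "cell (diag_span f) t (fM C M f)"
  shows "simply_presented C M (diag_span f, t, fM C M f) \<longleftrightarrow> (\<exists>p. loop f p \<and> t = graph f p)"
proof -
  have "span (diag_span f)" using assms by (simp add: cell_iff)
  from cell_cmp[OF assms cell_piM[OF this]]
  have "loop f (tens_pr2 C (diag_span f) MM \<cdot> t)" by (simp add: loop_def)
  moreover have "simply_presented C M (diag_span f, t, fM C M f) \<longleftrightarrow>
      t = graph f (tens_pr2 C (diag_span f) MM \<cdot> t)"
    by (simp add: simply_presented_def Let_def pair_cell_def bar_def piM_def arrow_def graph_def)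
  ultimately show ?thesis by (metis graph(3))
qed

lemma simply_presented_homs:
  "{\<alpha> \<in> homs Spans (diag_span f) (fM C M f). simply_presented C M \<alpha>} = {graph_cell f p | p. loop f p}"
  using graph(1) by (auto simp: graph_cell_def simply_presented_iff elim!: mem_homs_SpansE)

lemma ob_spEnd: "ob (spEnd C M) = {graph_cell f p | f p. loop f p}"
proof -
  have "ob (spEnd C M) =
      (\<Union>f \<in> ob Slice. {\<alpha> \<in> homs Spans (diag_span f) (fM C M f). simply_presented C M \<alpha>})"
    by (auto simp: spEnd_def EndM_def)
  then show ?thesis
    by (auto simp: simply_presented_homs mem_ob_slice loop_def cell_iff)
qed

text \<open>Closure under composition pastes two squares, using that tensoring with the identity of
  \<open>M\<close> preserves composites (\<open>tens_ar_cmp\<close>) and identities (\<open>tens_ar_idn\<close>).\<close>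

lemma category_EndM: "category (EndM C M)"
proof -
  interpret S: category Spans by (rule category_Spans)
  show ?thesis
    unfolding EndM_def
  proof (rule category_tagged_cat, goal_cases)
    case (1 \<alpha>)
    then obtain f a where \<alpha>: "\<alpha> = (diag_span f, a, fM C M f)" "cell (diag_span f) a (fM C M f)"
      by (auto elim!: mem_homs_SpansE)
    then have "span (diag_span f)" by (simp add: cell_iff)
    with \<alpha> show ?case
      using tens_ar_idn[of "diag_span f" MM] cell_idn[of "diag_span f"]
      by (simp add: id_mspan_def tens_eq cell_ar flip: fM_def)
  next
    case (2 \<alpha> \<beta> \<gamma> t t')
    from 2(1-3) obtain f a g b h c where
      a: "\<alpha> = (diag_span f, a, fM C M f)" "cell (diag_span f) a (fM C M f)" and
      b: "\<beta> = (diag_span g, b, fM C M g)" "cell (diag_span g) b (fM C M g)" and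
      c: "\<gamma> = (diag_span h, c, fM C M h)" "cell (diag_span h) c (fM C M h)"
      by (auto elim!: mem_homs_SpansE)
    let ?i = "idn C (apex C MM)"
    let ?T = "\<lambda>f t g. tens_ar (diag_span f) t (diag_span g) MM ?i MM"
    from 2(4) obtain s u where st: "t = (base_cell f s g, base_cell f u g)"
      "cell (diag_span f) s (diag_span g)" "cell (diag_span f) u (diag_span g)"
      "b \<cdot> s = ?T f u g \<cdot> a"
      by (auto simp: a b id_mspan_def base_cell_def tens_eq elim!: mem_homs_SpansE)
    from 2(5) obtain s' u' where st': "t' = (base_cell g s' h, base_cell g u' h)"
      "cell (diag_span g) s' (diag_span h)" "cell (diag_span g) u' (diag_span h)"
      "c \<cdot> s' = ?T g u' h \<cdot> b"
      by (auto simp: b c id_mspan_def base_cell_def tens_eq elim!: mem_homs_SpansE)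
    have T: "cell (fM C M f) (?T f u g) (fM C M g)" "cell (fM C M g) (?T g u' h) (fM C M h)"
      unfolding fM_def by (intro cell_tens_ar st(3) st'(3) cell_id_MM)+
    note ar = cell_ar[OF a(2)] cell_ar[OF b(2)] cell_ar[OF c(2)] cell_ar[OF st(2)]
      cell_ar[OF st'(2)] cell_ar[OF T(1)] cell_ar[OF T(2)]
    have "c \<cdot> (s' \<cdot> s) = (c \<cdot> s') \<cdot> s" by (rule assoc_ar[symmetric]) (simp_all add: ar)
    also have "\<dots> = ?T g u' h \<cdot> (b \<cdot> s)" unfolding st' by (rule assoc_ar) (simp_all add: ar)
    also have "\<dots> = (?T g u' h \<cdot> ?T f u g) \<cdot> a"
      unfolding st by (rule assoc_ar[symmetric]) (simp_all add: ar)
    also have "?T g u' h \<cdot> ?T f u g = ?T f (u' \<cdot> u) h"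
      using tens_ar_cmp[OF st(3) st'(3) cell_id_MM cell_id_MM] by simp
    finally show ?case
      using cell_cmp[OF st(2) st'(2)] cell_cmp[OF st(3) st'(3)]
      by (simp add: a(1) b(1) c(1) st(1) st'(1) base_cell_def id_mspan_def tens_eq fM_def)
  next
    case (3 \<alpha> \<beta> t)
    then show ?case by (auto simp: homs_def simp del: Spans_simps)
  next
    case (4 \<alpha> \<beta> t)
    then show ?case by (auto simp: homs_def simp del: Spans_simps)
  next
    case (5 \<alpha> \<beta> \<gamma> \<delta> t t' t'')
    then show ?case by (auto simp: homs_def simp del: Spans_simps)
  qed
qed

lemma category_spEnd: "category (spEnd C M)"
  unfolding spEnd_def by (rule category.category_full_subcat[OF category_EndM])

text \<open>Both sides of the square are elements of a pullback: \<open>(s, q \<circ> s)\<close> and \<open>(t, p)\<close>. Hence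
  morphisms between simply presented endomorphisms have equal components and are the morphisms
  of the corresponding loops.\<close>

lemma End_square_iff:
  assumes p: "loop f p" and q: "loop g q"
    and s: "cell (diag_span f) s (diag_span g)" and t: "cell (diag_span f) t (diag_span g)"
  shows "graph g q \<cdot> s = tens_ar (diag_span f) t (diag_span g) MM (idn C (apex C MM)) MM \<cdot> graph f p
    \<longleftrightarrow> s = t \<and> q \<cdot> s = p"
proof -
  let ?T = "tens_ar (diag_span f) t (diag_span g) MM (idn C (apex C MM)) MM"
  let ?P1 = "tens_pr1 C (diag_span g) MM" and ?P2 = "tens_pr2 C (diag_span g) MM"
  have D: "span (diag_span g)" using t by (simp add: cell_iff)
  have c: "composable (diag_span g) MM t p"
    using composable_cells[OF t cell_id_MM composable_graph[OF p]] p t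
    by (simp add: loop_iff cell_ar)
  have right: "?T \<cdot> graph f p = tens_pair C (diag_span g) MM t p"
    using tens_element[OF t cell_id_MM composable_graph[OF p]] p t
    by (simp add: loop_iff cell_ar graph_def)
  have left: "graph g q \<cdot> s = tens_pair C (diag_span g) MM s (q \<cdot> s)"
    using tens_pair_cmp[OF D span_MM composable_graph[OF q], of s] s q
    by (simp add: cell_ar graph_def loop_iff)
  have c': "composable (diag_span g) MM s (q \<cdot> s)"
    using composable_cmp[OF D span_MM composable_graph[OF q], of s] s q
    by (simp add: cell_ar loop_iff)
  show ?thesis
    unfolding left right using tens_pair(4,5)[OF D span_MM c] tens_pair(4,5)[OF D span_MM c']
    by metis
qed

lemma mem_ar_spEnd:
  "x \<in> ar (spEnd C M) \<longleftrightarrow>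
    (\<exists>f p g q t. x = (graph_cell f p, (base_cell f t g, base_cell f t g), graph_cell g q) \<and>
      loop f p \<and> loop g q \<and> cell (diag_span f) t (diag_span g) \<and> q \<cdot> t = p)"
proof -
  obtain \<alpha> \<sigma> \<tau> \<beta> where x: "x = (\<alpha>, (\<sigma>, \<tau>), \<beta>)" by (cases x) auto
  have "x \<in> ar (spEnd C M) \<longleftrightarrow> \<alpha> \<in> ob (spEnd C M) \<and> \<beta> \<in> ob (spEnd C M) \<and>
      \<sigma> \<in> homs Spans (dm Spans \<alpha>) (dm Spans \<beta>) \<and> \<tau> \<in> homs Spans (dm Spans \<alpha>) (dm Spans \<beta>) \<and>
      \<beta> \<cdot>\<^bsub>Spans\<^esub> \<sigma> = tens C \<tau> (id_mspan C M) \<cdot>\<^bsub>Spans\<^esub> \<alpha>"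
    by (auto simp: x spEnd_def EndM_def)
  also have "\<dots> \<longleftrightarrow> (\<exists>f p g q s t. x = (graph_cell f p, (base_cell f s g, base_cell f t g), graph_cell g q) \<and>
      loop f p \<and> loop g q \<and> cell (diag_span f) s (diag_span g) \<and> cell (diag_span f) t (diag_span g) \<and>
      graph g q \<cdot> s = tens_ar (diag_span f) t (diag_span g) MM (idn C (apex C MM)) MM \<cdot> graph f p)"
    unfolding ob_spEnd x
    by (auto simp: graph_cell_def base_cell_def id_mspan_def tens_eq fM_def elim!: mem_homs_SpansE) blast+
  finally show ?thesis using End_square_iff by blast
qed

lemma spEnd_simps [simp]:
  "dm (spEnd C M) (\<alpha>, x, \<beta>) = \<alpha>" "cd (spEnd C M) (\<alpha>, x, \<beta>) = \<beta>"
  "idn (spEnd C M) (graph_cell f p) =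
    (graph_cell f p, (base_cell f (idn C (dm C f)) f, base_cell f (idn C (dm C f)) f), graph_cell f p)"
  "(\<beta>', (base_cell g s' h, base_cell g t' h), \<gamma>) \<cdot>\<^bsub>spEnd C M\<^esub> (\<alpha>, (base_cell f s g', base_cell f t g'), \<beta>)
    = (\<alpha>, (base_cell f (s' \<cdot> s) h, base_cell f (t' \<cdot> t) h), \<gamma>)"
  by (simp_all add: spEnd_def EndM_def graph_cell_def base_cell_def)

lemma Q_fun_simps [simp]:
  "fo (Q_fun C M) (graph_cell f p) = f"
  "fm (Q_fun C M) (\<alpha>, (base_cell f t g, \<tau>), \<beta>) = (f, t, g)"
  by (simp_all add: Q_fun_def graph_cell_def base_cell_def to_slice_ar_def)

text \<open>Consecutive arrows meet in one and the same loop, because a graph determines its loop.\<close>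

lemma composable_arrows_spEndE:
  assumes "x \<in> homs (spEnd C M) \<alpha> \<beta>" "y \<in> homs (spEnd C M) \<beta> \<gamma>"
  obtains f p g q s h r t where
    "x = (graph_cell f p, (base_cell f s g, base_cell f s g), graph_cell g q)"
    "y = (graph_cell g q, (base_cell g t h, base_cell g t h), graph_cell h r)"
proof -
  have xy: "x \<in> ar (spEnd C M)" "y \<in> ar (spEnd C M)" "cd (spEnd C M) x = dm (spEnd C M) y"
    using assms by (simp_all add: homs_def)
  obtain f p g q s where x: "x = (graph_cell f p, (base_cell f s g, base_cell f s g), graph_cell g q)"
    "loop g q" using xy(1) unfolding mem_ar_spEnd by blast
  obtain g' q' h r t where
    y: "y = (graph_cell g' q', (base_cell g' t h, base_cell g' t h), graph_cell h r)" "loop g' q'"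
    using xy(2) unfolding mem_ar_spEnd by blast
  have "g' = g" "q' = q" using xy(3) x y by (simp_all add: graph_cell_inject)
  with x y that show ?thesis by blast
qed

lemma functor_Q: "cat_functor (spEnd C M) Slice (Q_fun C M)"
proof (intro cat_functor.intro cat_functor_axioms.intro category_spEnd category_slice)
  fix \<alpha> assume "\<alpha> \<in> ob (spEnd C M)"
  then obtain f p where [simp]: "\<alpha> = graph_cell f p" and "loop f p" by (auto simp: ob_spEnd)
  then show "fo (Q_fun C M) \<alpha> \<in> ob Slice"
    "fm (Q_fun C M) (idn (spEnd C M) \<alpha>) = idn Slice (fo (Q_fun C M) \<alpha>)"
    by (auto simp: mem_ob_slice loop_def cell_iff)
next
  fix x \<alpha> \<beta> assume "x \<in> homs (spEnd C M) \<alpha> \<beta>"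
  then show "fm (Q_fun C M) x \<in> homs Slice (fo (Q_fun C M) \<alpha>) (fo (Q_fun C M) \<beta>)"
    by (auto simp: homs_def mem_ar_spEnd mem_ar_slice)
next
  fix x y \<alpha> \<beta> \<gamma> assume "x \<in> homs (spEnd C M) \<alpha> \<beta>" "y \<in> homs (spEnd C M) \<beta> \<gamma>"
  then show "fm (Q_fun C M) (y \<cdot>\<^bsub>spEnd C M\<^esub> x) = fm (Q_fun C M) y \<cdot>\<^bsub>Slice\<^esub> fm (Q_fun C M) x"
    by (rule composable_arrows_spEndE) simp
qed

lemma lift_arrow_spEnd:
  assumes "loop g q" "cell (diag_span f) t (diag_span g)"
  shows "(graph_cell f (q \<cdot> t), (base_cell f t g, base_cell f t g), graph_cell g q) \<in> ar (spEnd C M)"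
  unfolding mem_ar_spEnd using assms loop_cmp[OF assms] by blast

lemma discrete_fibration_Q: "discrete_fibration (spEnd C M) Slice (Q_fun C M)"
proof (intro discrete_fibration.intro discrete_fibration_axioms.intro functor_Q)
  fix \<beta> u assume \<beta>: "\<beta> \<in> ob (spEnd C M)" and u: "u \<in> ar Slice" "cd Slice u = fo (Q_fun C M) \<beta>"
  obtain g q where \<beta>_eq [simp]: "\<beta> = graph_cell g q" and q: "loop g q" using \<beta> by (auto simp: ob_spEnd)
  obtain f t where u_eq [simp]: "u = (f, t, g)" using u(2) by (cases u) auto
  have t: "cell (diag_span f) t (diag_span g)" using u(1) by (simp add: mem_ar_slice)
  let ?x = "(graph_cell f (q \<cdot> t), (base_cell f t g, base_cell f t g), graph_cell g q)"
  show "\<exists>!x. x \<in> ar (spEnd C M) \<and> cd (spEnd C M) x = \<beta> \<and> fm (Q_fun C M) x = u"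
  proof (rule ex1I)
    show "?x \<in> ar (spEnd C M) \<and> cd (spEnd C M) ?x = \<beta> \<and> fm (Q_fun C M) ?x = u"
      using lift_arrow_spEnd[OF q t] by simp
  qed (auto simp: mem_ar_spEnd graph_cell_inject q)
qed

sublocale Q: discrete_fibration "spEnd C M" Slice "Q_fun C M"
  by (rule discrete_fibration_Q)

lemma Q_reindex:
  assumes "loop g q" "cell (diag_span f) t (diag_span g)"
  shows "Q.reindex (f, t, g) (graph_cell g q) = graph_cell f (q \<cdot> t)"
  using Q.reindex_eqI[OF lift_arrow_spEnd[OF assms]] by simp

lemma fibre_Q: "fibre (spEnd C M) (Q_fun C M) f = {graph_cell f p | p. loop f p}"
  by (auto simp: fibre_def ob_spEnd)

text \<open>Following the identity element through the Kleisli composite, it becomes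
  \<open>(id, q)\<close>, then \<open>((id, p), q)\<close>, then \<open>(id, (p, q))\<close>, then \<open>(id, p \<odot> q)\<close>.\<close>

lemma kleisli_monoid_simps:
  assumes "span (diag_span f)"
  shows "carrier (kleisli_monoid C M f) = {graph_cell f p | p. loop f p}"
    "loop f p \<Longrightarrow> loop f q \<Longrightarrow>
      graph_cell f p \<otimes>\<^bsub>kleisli_monoid C M f\<^esub> graph_cell f q = graph_cell f (p \<odot> q)"
    "\<one>\<^bsub>kleisli_monoid C M f\<^esub> = graph_cell f (idt M \<cdot> f)"
proof -
  let ?D = "diag_span f" and ?i = "idn C (dm C f)" and ?j = "idn C (apex C MM)"
  let ?T = "tens_ob C MM MM"
  note [simp] = assms
  have i: "cell ?D ?i ?D" using cell_idn[OF assms] by simp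
  have f: "f \<in> ar C" "cd C f = obj0 M" using assms by (simp_all add: span_diag)
  show "carrier (kleisli_monoid C M f) = {graph_cell f p | p. loop f p}"
    by (simp add: kleisli_monoid_def simply_presented_homs)
  have "composable ?D unit ?i f" using f by (simp add: composable_def)
  from tens_element[OF i cell_eta this]
  show "\<one>\<^bsub>kleisli_monoid C M f\<^esub> = graph_cell f (idt M \<cdot> f)"
    using f by (simp add: kleisli_monoid_def eta_cell_def runit_cell_def graph_cell_def graph_def
        tens_eq fM_def)
  assume p: "loop f p" and q: "loop f q"
  let ?X = "tens_ar ?D ?i ?D ?T (mul M) MM" and ?A = "tens_assoc_ar ?D MM MM"
    and ?B = "tens_ar ?D (graph f p) (fM C M f) MM ?j MM"
  note pq = composable_loops[OF p q]
  have r: "composable ?D ?T ?i (tens_pair C MM MM p q)"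
    by (rule composable_tens_right[OF assms span_MM span_MM composable_graph[OF p] pq])
  have cells: "cell (tens_ob C ?D ?T) ?X (tens_ob C ?D MM)"
    "cell (tens_ob C ?D MM) ?B (tens_ob C (fM C M f) MM)"
    by (intro cell_tens_ar i cell_mu graph(1)[OF p] cell_id_MM)+
  note ar = cell_ar[OF cells(1)] cell_ar[OF cells(2)] cell_ar[OF graph(1)[OF q]]
    tens_assoc_ar[OF assms span_MM span_MM]
  have "((?X \<cdot> ?A) \<cdot> ?B) \<cdot> graph f q = ?X \<cdot> (?A \<cdot> (?B \<cdot> graph f q))"
    using ar by (simp add: fM_def)
  also have "?B \<cdot> graph f q = tens_pair C (fM C M f) MM (graph f p) q"
    using tens_element[OF graph(1)[OF p] cell_id_MM composable_graph[OF q]]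
      cell_ar[OF graph(1)[OF p]] q by (simp add: graph_def[of f q] loop_iff)
  also have "?A \<cdot> \<dots> = tens_pair C ?D ?T ?i (tens_pair C MM MM p q)"
    unfolding fM_def graph_def
    by (rule assoc_element[OF assms span_MM span_MM composable_graph[OF p] pq])
  also have "?X \<cdot> \<dots> = graph f (p \<odot> q)"
    using tens_element[OF i cell_mu r] f by (simp add: graph_def mult_def)
  finally show "graph_cell f p \<otimes>\<^bsub>kleisli_monoid C M f\<^esub> graph_cell f q = graph_cell f (p \<odot> q)"
    by (simp add: kleisli_monoid_def graph_cell_def tens_eq mu_cell_def id_mspan_def assoc_cell_eq fM_def)
qed

lemma monoid_kleisli:
  assumes "span (diag_span f)"
  shows "monoid (kleisli_monoid C M f)"
proof (rule monoidI)
  note [simp] = kleisli_monoid_simps[OF assms] loop_mult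
  fix x y z
  assume "x \<in> carrier (kleisli_monoid C M f)" "y \<in> carrier (kleisli_monoid C M f)"
    "z \<in> carrier (kleisli_monoid C M f)"
  then show "(x \<otimes>\<^bsub>kleisli_monoid C M f\<^esub> y) \<otimes>\<^bsub>kleisli_monoid C M f\<^esub> z =
      x \<otimes>\<^bsub>kleisli_monoid C M f\<^esub> (y \<otimes>\<^bsub>kleisli_monoid C M f\<^esub> z)"
    using mult_assoc composable_loops by auto
qed (use assms in \<open>auto simp: kleisli_monoid_simps loop_mult loop_one mult_one_left mult_one_right\<close>)

lemma factors_over_Mon_Q:
  "factors_over_Mon (op_cat Slice) (base_change (spEnd C M) Slice (Q_fun C M)) (kleisli_monoid C M)"
proof (rule Q.factors_over_MonI)
  fix f assume "f \<in> ob Slice"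
  then show "carrier (kleisli_monoid C M f) = fibre (spEnd C M) (Q_fun C M) f" "monoid (kleisli_monoid C M f)"
    by (simp_all add: mem_ob_slice kleisli_monoid_simps fibre_Q monoid_kleisli)
next
  fix u assume "u \<in> ar Slice"
  then obtain f t g where u: "u = (f, t, g)" and t: "cell (diag_span f) t (diag_span g)"
    by (cases u) (simp add: mem_ar_slice)
  then have fg: "span (diag_span f)" "span (diag_span g)" by (auto simp: cell_iff)
  note [simp] = kleisli_monoid_simps[OF fg(1)] kleisli_monoid_simps[OF fg(2)] Q_reindex[OF _ t]
    loop_mult loop_one[OF fg(2)] loop_cmp[OF _ t] mult_loops_cmp[OF _ _ t] one_cmp[OF t]
  show "Q.reindex u \<in> hom (kleisli_monoid C M (cd Slice u)) (kleisli_monoid C M (dm Slice u))"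
    unfolding u by (auto simp: hom_def)
  show "Q.reindex u \<one>\<^bsub>kleisli_monoid C M (cd Slice u)\<^esub> = \<one>\<^bsub>kleisli_monoid C M (dm Slice u)\<^esub>"
    unfolding u by simp
qed


section \<open>The isomorphism between the two fibrations\<close>

definition E_fun :: "('m cell, 'm cell \<times> 'm cell \<times> 'm cell,
    'm cell, 'm cell \<times> ('m cell \<times> 'm cell) \<times> 'm cell) func" where
  "E_fun = \<lparr>fo = tilde C M, fm = \<lambda>(\<alpha>, \<phi>, \<beta>). (tilde C M \<alpha>, (\<phi>, \<phi>), tilde C M \<beta>)\<rparr>"

definition L_fun :: "('m cell, 'm cell \<times> ('m cell \<times> 'm cell) \<times> 'm cell,
    'm cell, 'm cell \<times> 'm cell \<times> 'm cell) func" where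
  "L_fun = \<lparr>fo = bar C M, fm = \<lambda>(\<alpha>, (\<sigma>, \<tau>), \<beta>). (bar C M \<alpha>, \<sigma>, bar C M \<beta>)\<rparr>"

lemma E_fun_simps [simp]:
  "fo E_fun \<alpha> = tilde C M \<alpha>" "fm E_fun (\<alpha>, \<phi>, \<beta>) = (tilde C M \<alpha>, (\<phi>, \<phi>), tilde C M \<beta>)"
  by (simp_all add: E_fun_def)

lemma L_fun_simps [simp]:
  "fo L_fun \<alpha> = bar C M \<alpha>" "fm L_fun (\<alpha>, (\<sigma>, \<tau>), \<beta>) = (bar C M \<alpha>, \<sigma>, bar C M \<beta>)"
  by (simp_all add: L_fun_def)

lemma functor_E: "cat_functor (Conv C M) (spEnd C M) E_fun"
proof (intro cat_functor.intro cat_functor_axioms.intro category_Conv category_spEnd)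
  fix x \<alpha> \<beta> assume "x \<in> homs (Conv C M) \<alpha> \<beta>"
  then show "fm E_fun x \<in> homs (spEnd C M) (fo E_fun \<alpha>) (fo E_fun \<beta>)"
    by (auto simp: homs_def mem_ar_Conv tilde_loop_cell intro: lift_arrow_spEnd)
next
  fix x y \<alpha> \<beta> \<gamma> assume "x \<in> homs (Conv C M) \<alpha> \<beta>" "y \<in> homs (Conv C M) \<beta> \<gamma>"
  then show "fm E_fun (y \<cdot>\<^bsub>Conv C M\<^esub> x) = fm E_fun y \<cdot>\<^bsub>spEnd C M\<^esub> fm E_fun x"
    by (auto simp: homs_def mem_ar_Conv)
next
  fix \<alpha> assume "\<alpha> \<in> ob (Conv C M)"
  then obtain f p where "\<alpha> = loop_cell f p" "loop f p" by (auto simp: ob_Conv)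
  then show "fo E_fun \<alpha> \<in> ob (spEnd C M)"
    "fm E_fun (idn (Conv C M) \<alpha>) = idn (spEnd C M) (fo E_fun \<alpha>)"
    unfolding ob_spEnd by (simp_all add: tilde_loop_cell) blast
qed

lemma functor_L: "cat_functor (spEnd C M) (Conv C M) L_fun"
proof (intro cat_functor.intro cat_functor_axioms.intro category_Conv category_spEnd)
  fix x \<alpha> \<beta> assume "x \<in> homs (spEnd C M) \<alpha> \<beta>"
  then show "fm L_fun x \<in> homs (Conv C M) (fo L_fun \<alpha>) (fo L_fun \<beta>)"
    by (auto simp: homs_def mem_ar_spEnd bar_graph_cell intro: lift_arrow_Conv)
next
  fix x y \<alpha> \<beta> \<gamma> assume "x \<in> homs (spEnd C M) \<alpha> \<beta>" "y \<in> homs (spEnd C M) \<beta> \<gamma>"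
  then show "fm L_fun (y \<cdot>\<^bsub>spEnd C M\<^esub> x) = fm L_fun y \<cdot>\<^bsub>Conv C M\<^esub> fm L_fun x"
    by (rule composable_arrows_spEndE) simp
next
  fix \<alpha> assume "\<alpha> \<in> ob (spEnd C M)"
  then obtain f p where "\<alpha> = graph_cell f p" "loop f p" by (auto simp: ob_spEnd)
  then show "fo L_fun \<alpha> \<in> ob (Conv C M)"
    "fm L_fun (idn (spEnd C M) \<alpha>) = idn (Conv C M) (fo L_fun \<alpha>)"
    by (simp_all add: ob_Conv bar_graph_cell)
qed

lemma cartesian_iso_E_L:
  "cartesian_iso (Conv C M) (spEnd C M) Slice (P_fun C M) (Q_fun C M) E_fun L_fun"
proof (rule cartesian_isoI[OF discrete_fibration_P discrete_fibration_Q functor_E functor_L])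
  show "same_func (Conv C M) (comp_func L_fun E_fun) id_func"
    "same_func (Conv C M) (comp_func (Q_fun C M) E_fun) (P_fun C M)"
    unfolding same_func_def Ball_def ob_Conv mem_ar_Conv comp_func_def id_func_def
    by (elim CollectE exE conjE |
        simp only: func.simps | intro conjI allI impI | simp add: tilde_loop_cell bar_graph_cell)+
  show "same_func (spEnd C M) (comp_func E_fun L_fun) id_func"
    "same_func (spEnd C M) (comp_func (P_fun C M) L_fun) (Q_fun C M)"
    unfolding same_func_def Ball_def ob_spEnd mem_ar_spEnd comp_func_def id_func_def
    by (elim CollectE exE conjE |
        simp only: func.simps | intro conjI allI impI | simp add: tilde_loop_cell bar_graph_cell)+
qed

sublocale cartesian_isomorphism "Conv C M" Slice "P_fun C M" "spEnd C M" "Q_fun C M" E_fun L_fun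
  by unfold_locales (rule cartesian_iso_E_L)

end

theorem proposition22:
  fixes C :: "('o, 'm) pb_cat" and M :: "('o, 'm) internal_cat"
  assumes "category C" and "finitely_complete C" and "chosen_pullbacks C"
    and "internal_category C M"
  defines "A \<equiv> slice C (obj0 M)"
  defines "P_star \<equiv> base_change (Conv C M) A (P_fun C M)"
    and "Q_star \<equiv> base_change (spEnd C M) A (Q_fun C M)"
  shows "discrete_fibration (Conv C M) A (P_fun C M) \<and>
    discrete_fibration (spEnd C M) A (Q_fun C M) \<and>
    factors_over_Mon (op_cat A) P_star (conv_monoid C M) \<and>
    factors_over_Mon (op_cat A) Q_star (kleisli_monoid C M) \<and>
    (\<exists>\<theta> E L.
      natural_iso (op_cat A) set_cat P_star Q_star \<theta> \<and>
      cartesian_iso (Conv C M) (spEnd C M) A (P_fun C M) (Q_fun C M) E L \<and>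
      (\<forall>f\<in>ob A. \<theta> f = (fo P_star f, \<lambda>\<alpha>\<in>fo P_star f. fo E \<alpha>, fo Q_star f)) \<and>
      (\<forall>\<alpha>\<in>ob (Conv C M). fo E \<alpha> = tilde C M \<alpha>) \<and>
      (\<forall>\<alpha> \<phi> \<beta>. (\<alpha>, \<phi>, \<beta>) \<in> ar (Conv C M) \<longrightarrow>
        fm E (\<alpha>, \<phi>, \<beta>) = (tilde C M \<alpha>, (\<phi>, \<phi>), tilde C M \<beta>)) \<and>
      (\<forall>\<alpha>\<in>ob (spEnd C M). fo L \<alpha> = bar C M \<alpha>) \<and>
      (\<forall>\<alpha> \<phi> \<beta>. (\<alpha>, (\<phi>, \<phi>), \<beta>) \<in> ar (spEnd C M) \<longrightarrow>
        fm L (\<alpha>, (\<phi>, \<phi>), \<beta>) = (bar C M \<alpha>, \<phi>, bar C M \<beta>)))"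
proof -
  interpret category C by fact
  interpret internal_category C M by fact
  interpret monoid_in_spans C M
    by unfold_locales (use assms(3) obj0 in auto)
  show ?thesis
    unfolding P_star_def Q_star_def A_def
    using discrete_fibration_P discrete_fibration_Q factors_over_Mon_P factors_over_Mon_Q
      natural_iso_base_change cartesian_iso_E_L
    by (intro conjI exI[of _ "\<lambda>f. (fibre (Conv C M) (P_fun C M) f,
        \<lambda>\<alpha>\<in>fibre (Conv C M) (P_fun C M) f. fo E_fun \<alpha>, fibre (spEnd C M) (Q_fun C M) f)"]
        exI[of _ E_fun] exI[of _ L_fun]) simp_all
qed

end
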